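(* Let $X$ be a càdlàg process such that $\mathbb{P}[\Delta X_L\neq 0]=0$, with natural filtration $\mathcal{F}^X$, and let $(X^n)_n$ be a sequence of càdlàg processes with natural filtrations $(\mathcal{F}^n)_n$. Suppose that $X^n\to X$ in probability. Then $$\Gamma(L)\leqslant\liminf_{n\to\infty}\Gamma_n(L),$$ where $\Gamma(L)=\sup\{\mathbb{E}[\gamma(\tau,X_\tau)] : \tau \text{ an } \mathcal{F}^X\text{-stopping time bounded by } L\}$ and $\Gamma_n(L)=\sup\{\mathbb{E}[\gamma(\tau,X^n_\tau)] : \tau \text{ an } \mathcal{F}^n\text{-stopping time bounded by } L\}$.
   Context: $(\Omega,\mathcal{A},\mathbb{P})$ is a fixed probability space, $T>0$ is fixed and $L\in[0,T]$ is fixed. All processes are real-valued and indexed by $[0,T]$; all filtrations are indexed by $[0,T]$. $\mathbb{D}=\mathbb{D}([0,T])$ is the space of càdlàg functions $[0,T]\to\mathbb{R}$ with the Skorokhod topology; convergence in probability of càdlàg processes is convergence in probability as $\mathbb{D}$-valued random variables. $\gamma:[0,+\infty[\times\mathbb{R}\to\mathbb{R}$ is a fixed bounded continuous function. *)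

theory Defs
  imports "HOL-Probability.Probability"
begin

text \<open>
  Functions on \<open>[0,T]\<close> and processes indexed by \<open>[0,T]\<close> are modelled by total functions of a real
  time argument; every notion below looks only at the times in \<open>[0,T]\<close>.
\<close>

definition cadlag :: "real \<Rightarrow> (real \<Rightarrow> real) \<Rightarrow> bool" where
  "cadlag T x \<longleftrightarrow>
     (\<forall>t\<in>{0..T}. continuous (at t within {t..T}) x) \<and>
     (\<forall>t\<in>{0<..T}. \<exists>l. (x \<longlongrightarrow> l) (at_left t))"

text \<open>The convention at time \<open>0\<close> is \<open>x (0-) = x 0\<close>, so there is no jump there.\<close>

definition jump :: "(real \<Rightarrow> real) \<Rightarrow> real \<Rightarrow> real" where
  "jump x t = (if t > 0 then x t - Lim (at_left t) x else 0)"

definition time_changes :: "real \<Rightarrow> (real \<Rightarrow> real) set" where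
  "time_changes T =
     {\<mu>. continuous_on {0..T} \<mu> \<and> strict_mono_on {0..T} \<mu> \<and> \<mu> ` {0..T} = {0..T}}"

text \<open>
  Skorokhod's metric for the \<open>J\<^sub>1\<close> topology (Billingsley). The infimum is over a nonempty set for
  cadlag functions, because these are bounded on \<open>[0,T]\<close>.
\<close>

definition skorokhod_dist :: "real \<Rightarrow> (real \<Rightarrow> real) \<Rightarrow> (real \<Rightarrow> real) \<Rightarrow> real" where
  "skorokhod_dist T x y =
     Inf {\<epsilon>. \<epsilon> > 0 \<and> (\<exists>\<mu>\<in>time_changes T. \<forall>t\<in>{0..T}. \<bar>\<mu> t - t\<bar> \<le> \<epsilon> \<and> \<bar>x t - y (\<mu> t)\<bar> \<le> \<epsilon>)}"

definition cadlag_process :: "'a measure \<Rightarrow> real \<Rightarrow> (real \<Rightarrow> 'a \<Rightarrow> real) \<Rightarrow> bool" where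
  "cadlag_process M T X \<longleftrightarrow>
     (\<forall>t\<in>{0..T}. X t \<in> borel_measurable M) \<and> (\<forall>\<omega>\<in>space M. cadlag T (\<lambda>t. X t \<omega>))"

text \<open>
  For cadlag processes the event below is measurable (the Skorokhod space is separable), and on
  measurable sets \<^const>\<open>outer_measure_of\<close> is the probability itself. It is used instead of
  \<^const>\<open>measure\<close> since the latter would take the default value \<open>0\<close> on non-measurable sets.
\<close>

definition skorokhod_tendsto_in_prob ::
    "'a measure \<Rightarrow> real \<Rightarrow> (nat \<Rightarrow> real \<Rightarrow> 'a \<Rightarrow> real) \<Rightarrow> (real \<Rightarrow> 'a \<Rightarrow> real) \<Rightarrow> bool" where
  "skorokhod_tendsto_in_prob M T Xs X \<longleftrightarrow>
     (\<forall>\<epsilon>>0. (\<lambda>n. outer_measure_of M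
        {\<omega> \<in> space M. skorokhod_dist T (\<lambda>t. Xs n t \<omega>) (\<lambda>t. X t \<omega>) > \<epsilon>}) \<longlonglongrightarrow> 0)"

text \<open>
  The natural filtration, neither completed nor made right-continuous. To fit the library's
  \<^const>\<open>stopping_time\<close>, whose index set is a whole type, it is extended to real times, as the trivial
  sigma-algebra before \<open>0\<close> and as the sigma-algebra at time \<open>T\<close> after \<open>T\<close>.
\<close>

definition natural_filtration ::
    "'a measure \<Rightarrow> real \<Rightarrow> (real \<Rightarrow> 'a \<Rightarrow> real) \<Rightarrow> real \<Rightarrow> 'a measure" where
  "natural_filtration M T X t =
     sigma (space M) {X s -` B \<inter> space M | s B. s \<in> {0..T} \<and> s \<le> t \<and> B \<in> sets borel}"

lemma space_natural_filtration [simp]: "space (natural_filtration M T X t) = space M"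
  unfolding natural_filtration_def by (rule space_measure_of) auto

lemma filtration_natural_filtration: "filtration (space M) (natural_filtration M T X)"
proof
  fix s t :: real
  assume "s \<le> t"
  then have "{X r -` B \<inter> space M | r B. r \<in> {0..T} \<and> r \<le> s \<and> B \<in> sets borel}
      \<subseteq> {X r -` B \<inter> space M | r B. r \<in> {0..T} \<and> r \<le> t \<and> B \<in> sets borel}"
    by (blast intro: order_trans)
  then show "sets (natural_filtration M T X s) \<subseteq> sets (natural_filtration M T X t)"
    unfolding natural_filtration_def
    by (subst (1 2) sets_measure_of) (blast intro: sigma_sets_mono'[THEN subsetD])+
qed simp

definition stopping_times_upto ::
    "'a measure \<Rightarrow> (real \<Rightarrow> 'a measure) \<Rightarrow> real \<Rightarrow> ('a \<Rightarrow> real) set" where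
  "stopping_times_upto M F L = {\<tau>. stopping_time F \<tau> \<and> (\<forall>\<omega>\<in>space M. \<tau> \<omega> \<in> {0..L})}"

text \<open>The extension to times outside \<open>[0,T]\<close> does not affect the set of stopping times.\<close>

lemma stopping_times_upto_natural_filtration_iff:
  assumes "L \<le> T"
  shows "\<tau> \<in> stopping_times_upto M (natural_filtration M T X) L \<longleftrightarrow>
     (\<forall>\<omega>\<in>space M. \<tau> \<omega> \<in> {0..L}) \<and>
     (\<forall>t\<in>{0..T}. {\<omega> \<in> space M. \<tau> \<omega> \<le> t} \<in> sets (natural_filtration M T X t))"
proof -
  have "{\<omega> \<in> space M. \<tau> \<omega> \<le> t} \<in> sets (natural_filtration M T X t)"
    if \<tau>: "\<forall>\<omega>\<in>space M. \<tau> \<omega> \<in> {0..L}" and t: "t \<notin> {0..T}" for t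
  proof (cases "t < 0")
    case True
    then have "{\<omega> \<in> space M. \<tau> \<omega> \<le> t} = {}"
      using \<tau> by force
    then show ?thesis by (simp only: sets.empty_sets)
  next
    case False
    then have "{\<omega> \<in> space M. \<tau> \<omega> \<le> t} = space (natural_filtration M T X t)"
      using \<tau> t assms by fastforce
    then show ?thesis by (metis sets.top)
  qed
  then show ?thesis
    unfolding stopping_times_upto_def stopping_time_def pred_def by auto
qed

definition optimal_value ::
    "'a measure \<Rightarrow> real \<Rightarrow> (real \<times> real \<Rightarrow> real) \<Rightarrow> (real \<Rightarrow> 'a \<Rightarrow> real) \<Rightarrow> real \<Rightarrow> real" where
  "optimal_value M T \<gamma> X L =
     (SUP \<tau> \<in> stopping_times_upto M (natural_filtration M T X) L.
        prob_space.expectation M (\<lambda>\<omega>. \<gamma> (\<tau> \<omega>, X (\<tau> \<omega>) \<omega>)))"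

end

theory Submission
  imports Defs
begin

text \<open>
  Given a stopping time \<open>\<tau>\<close> of the limit process, almost the same expected reward has to be obtained
  by stopping times of the processes \<open>X\<^sup>n\<close>, for all large \<open>n\<close>.

  The argument takes place at the times at which \<open>X\<close> has almost surely no jump. A cadlag path has only
  finitely many jumps above any given size, so all but countably many times are of this kind
  (\<open>countable_fixed_discontinuities\<close>), and \<open>L\<close> is one of them by assumption. At such a time \<open>s\<close>,
  Skorokhod convergence in probability implies \<open>X\<^sup>n\<^sub>s \<rightarrow> X\<^sub>s\<close> in probability
  (\<open>skorokhod_converges_at_continuity_time\<close>).

  Rounding \<open>\<tau>\<close> up to finite sets of continuity times in \<open>[0,L]\<close> gives stopping times that converge to
  \<open>\<tau>\<close> from above, and right-continuity of the paths makes the expected rewards converge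
  (\<open>expectation_rounded_up_tendsto\<close>). So \<open>\<tau>\<close> may be assumed to have finitely many values, all of them
  continuity times.

  The filtrations are connected by the following observation. Consider the events \<open>A\<close> for which there
  are events \<open>A\<^sub>n\<close> of the past of \<open>X\<^sup>n\<close> up to \<open>t\<close> such that the symmetric difference of \<open>A\<close> and \<open>A\<^sub>n\<close> has
  probability tending to \<open>0\<close>. They form a sigma-algebra, and by convergence in probability it contains
  the events \<open>X\<^sub>s > a\<close> for continuity times \<open>s \<le> t\<close>. If \<open>t\<close> is itself a continuity time, these generate
  the past of \<open>X\<close> up to \<open>t\<close>, and every event of that past can be approximated
  (\<open>natural_filtration_approximable\<close>).

  For a finitely valued \<open>\<tau>\<close>, each event \<open>\<tau> \<le> p\<close> is replaced by an approximating event of the past of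
  \<open>X\<^sup>n\<close> up to \<open>p\<close>. The first \<open>p\<close> whose event occurs is a stopping time for \<open>X\<^sup>n\<close> that equals \<open>\<tau>\<close> with
  high probability, and the rewards at the finitely many times \<open>p\<close> converge in probability
  (\<open>transfer_finitely_valued_stopping_time\<close>).
\<close>

section \<open>Cadlag paths and the Skorokhod distance\<close>

lemma cadlag_tendsto_left:
  assumes "cadlag T x" "t \<in> {0<..T}"
  shows "(x \<longlongrightarrow> Lim (at_left t) x) (at_left t)"
  using assms unfolding cadlag_def by (metis tendsto_Lim trivial_limit_at_left_real)

lemma cadlag_one_sided_bounds:
  assumes "cadlag T x" "u \<in> {0..T}" "e > 0"
  obtains \<eta> where "\<eta> > 0"
    "\<And>v. v \<in> {0..T} \<Longrightarrow> u - \<eta> < v \<Longrightarrow> v < u \<Longrightarrow> \<bar>x v - Lim (at_left u) x\<bar> < e"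
    "\<And>v. v \<in> {0..T} \<Longrightarrow> u \<le> v \<Longrightarrow> v < u + \<eta> \<Longrightarrow> \<bar>x v - x u\<bar> < e"
proof -
  have "continuous (at u within {u..T}) x"
    using assms unfolding cadlag_def by blast
  then obtain d1 where d1: "d1 > 0" "\<And>v. v \<in> {u..T} \<Longrightarrow> dist v u < d1 \<Longrightarrow> dist (x v) (x u) < e"
    unfolding continuous_within_eps_delta using \<open>e > 0\<close> by blast
  have "\<exists>d2>0. \<forall>v\<in>{0..T}. u - d2 < v \<and> v < u \<longrightarrow> \<bar>x v - Lim (at_left u) x\<bar> < e"
  proof (cases "u = 0")
    case True
    then show ?thesis by (intro exI[of _ 1]) auto
  next
    case False
    then have "(x \<longlongrightarrow> Lim (at_left u) x) (at_left u)"
      using assms by (intro cadlag_tendsto_left) auto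
    then have "\<forall>\<^sub>F v in at_left u. dist (x v) (Lim (at_left u) x) < e"
      using \<open>e > 0\<close> by (rule tendstoD)
    then obtain b where "b < u" "\<And>v. b < v \<Longrightarrow> v < u \<Longrightarrow> dist (x v) (Lim (at_left u) x) < e"
      unfolding eventually_at_left_field by blast
    then show ?thesis
      by (intro exI[of _ "u - b"]) (auto simp: dist_real_def)
  qed
  then obtain d2 where d2: "d2 > 0"
    "\<And>v. v \<in> {0..T} \<Longrightarrow> u - d2 < v \<Longrightarrow> v < u \<Longrightarrow> \<bar>x v - Lim (at_left u) x\<bar> < e"
    by blast
  show ?thesis
    using d1 d2 by (intro that[of "min d1 d2"]) (auto simp: dist_real_def)
qed

lemma cadlag_continuous_within_if_no_jump:
  assumes "cadlag T x" "t \<in> {0..T}" "jump x t = 0" "e > 0"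
  obtains \<eta> where "\<eta> > 0" "\<And>v. v \<in> {0..T} \<Longrightarrow> \<bar>v - t\<bar> < \<eta> \<Longrightarrow> \<bar>x v - x t\<bar> < e"
proof -
  obtain \<eta> where \<eta>: "\<eta> > 0"
    "\<And>v. v \<in> {0..T} \<Longrightarrow> t - \<eta> < v \<Longrightarrow> v < t \<Longrightarrow> \<bar>x v - Lim (at_left t) x\<bar> < e"
    "\<And>v. v \<in> {0..T} \<Longrightarrow> t \<le> v \<Longrightarrow> v < t + \<eta> \<Longrightarrow> \<bar>x v - x t\<bar> < e"
    using cadlag_one_sided_bounds[OF assms(1,2,4)] by blast
  have "\<bar>x v - x t\<bar> < e" if v: "v \<in> {0..T}" "\<bar>v - t\<bar> < \<eta>" for v
  proof (cases "v < t")
    case True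
    then have "Lim (at_left t) x = x t"
      using assms v by (auto simp: jump_def split: if_splits)
    then show ?thesis using \<eta>(2)[of v] True v by auto
  next
    case False
    then show ?thesis using \<eta>(3)[of v] v by auto
  qed
  with \<eta>(1) show ?thesis by (rule that)
qed

text \<open>A path is bounded near every time because of its one-sided limits, and \<open>[0,T]\<close> is compact.\<close>

lemma cadlag_bounded:
  assumes "cadlag T x"
  obtains C where "\<And>t. t \<in> {0..T} \<Longrightarrow> \<bar>x t\<bar> \<le> C"
proof -
  have "\<exists>\<eta>>0. \<exists>C. \<forall>v\<in>{0..T}. \<bar>v - u\<bar> < \<eta> \<longrightarrow> \<bar>x v\<bar> \<le> C" if u: "u \<in> {0..T}" for u
  proof -
    obtain \<eta> where \<eta>: "\<eta> > 0"
      "\<And>v. v \<in> {0..T} \<Longrightarrow> u - \<eta> < v \<Longrightarrow> v < u \<Longrightarrow> \<bar>x v - Lim (at_left u) x\<bar> < 1"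
      "\<And>v. v \<in> {0..T} \<Longrightarrow> u \<le> v \<Longrightarrow> v < u + \<eta> \<Longrightarrow> \<bar>x v - x u\<bar> < 1"
      using cadlag_one_sided_bounds[OF assms u, of 1] by auto
    have "\<bar>x v\<bar> \<le> \<bar>x u\<bar> + \<bar>Lim (at_left u) x\<bar> + 1" if "v \<in> {0..T}" "\<bar>v - u\<bar> < \<eta>" for v
      using \<eta>(2,3)[of v] that by (cases "v < u") auto
    with \<eta>(1) show ?thesis by blast
  qed
  then obtain \<eta> C where \<eta>: "\<And>u. u \<in> {0..T} \<Longrightarrow> \<eta> u > 0"
    and C: "\<And>u v. u \<in> {0..T} \<Longrightarrow> v \<in> {0..T} \<Longrightarrow> \<bar>v - u\<bar> < \<eta> u \<Longrightarrow> \<bar>x v\<bar> \<le> C u"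
    by metis
  have "{0..T} \<subseteq> (\<Union>u\<in>{0..T}. ball u (\<eta> u))"
    using \<eta> by auto
  then obtain U where U: "U \<subseteq> {0..T}" "finite U" "{0..T} \<subseteq> (\<Union>u\<in>U. ball u (\<eta> u))"
    by (rule compactE_image[OF compact_Icc open_ball])
  have "\<bar>x t\<bar> \<le> (\<Sum>u\<in>U. \<bar>C u\<bar>)" if t: "t \<in> {0..T}" for t
  proof -
    obtain u where u: "u \<in> U" "\<bar>t - u\<bar> < \<eta> u"
      using U(3) t by (auto simp: dist_real_def abs_minus_commute)
    then have "\<bar>x t\<bar> \<le> \<bar>C u\<bar>"
      using C[of u t] U(1) t by fastforce
    also have "\<dots> \<le> (\<Sum>u\<in>U. \<bar>C u\<bar>)"
      using u U(2) by (intro member_le_sum) auto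
    finally show ?thesis .
  qed
  then show ?thesis by (rule that)
qed

text \<open>
  An accumulation point of large jumps is impossible: on each side of it the path stays close to a
  one-sided limit, so that the jumps there are small.
\<close>

lemma cadlag_finite_large_jumps:
  assumes "cadlag T x" "\<delta> > 0"
  shows "finite {t \<in> {0..T}. \<bar>jump x t\<bar> > \<delta>}"
proof (rule ccontr)
  assume "infinite {t \<in> {0..T}. \<bar>jump x t\<bar> > \<delta>}"
  moreover have "{t \<in> {0..T}. \<bar>jump x t\<bar> > \<delta>} \<subseteq> {0..T}"
    by blast
  ultimately obtain u where u: "u \<in> {0..T}" "u islimpt {t \<in> {0..T}. \<bar>jump x t\<bar> > \<delta>}"
    using Heine_Borel_imp_Bolzano_Weierstrass[OF compact_Icc] by blast
  define e where "e = \<delta> / 3"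
  have "e > 0" using assms by (simp add: e_def)
  obtain \<eta> where \<eta>: "\<eta> > 0"
    "\<And>v. v \<in> {0..T} \<Longrightarrow> u - \<eta> < v \<Longrightarrow> v < u \<Longrightarrow> \<bar>x v - Lim (at_left u) x\<bar> < e"
    "\<And>v. v \<in> {0..T} \<Longrightarrow> u \<le> v \<Longrightarrow> v < u + \<eta> \<Longrightarrow> \<bar>x v - x u\<bar> < e"
    using cadlag_one_sided_bounds[OF assms(1) u(1) \<open>e > 0\<close>] by blast
  obtain v where v: "v \<in> {0..T}" "\<bar>jump x v\<bar> > \<delta>" "v \<noteq> u" "\<bar>v - u\<bar> < \<eta>"
    using u(2) \<eta>(1) unfolding islimpt_approachable by (auto simp: dist_real_def)
  have "v > 0" using v(2) assms(2) by (auto simp: jump_def split: if_splits)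
  define c where "c = (if v < u then Lim (at_left u) x else x u)"
  define b where "b = (if v < u then max 0 (u - \<eta>) else u)"
  have "b < v"
    using v \<open>v > 0\<close> by (auto simp: b_def)
  have near: "\<bar>x w - c\<bar> < e" if "b < w" "w \<le> v" for w
    using that v u(1) \<eta>(2,3)[of w] by (auto simp: b_def c_def split: if_splits)
  have "((\<lambda>w. \<bar>x w - c\<bar>) \<longlongrightarrow> \<bar>Lim (at_left v) x - c\<bar>) (at_left v)"
    using v \<open>v > 0\<close> assms(1) by (intro tendsto_intros cadlag_tendsto_left) auto
  moreover have "\<forall>\<^sub>F w in at_left v. \<bar>x w - c\<bar> \<le> e"
    unfolding eventually_at_left_field using near \<open>b < v\<close> by (intro exI[of _ b]) force
  ultimately have "\<bar>Lim (at_left v) x - c\<bar> \<le> e"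
    by (rule tendsto_upperbound) simp
  moreover have "\<bar>x v - c\<bar> < e" using near \<open>b < v\<close> by simp
  ultimately have "\<bar>x v - Lim (at_left v) x\<bar> < 2 * e"
    by linarith
  then show False
    using v(2) \<open>v > 0\<close> \<open>e > 0\<close> by (simp add: jump_def e_def)
qed

text \<open>
  Right-continuity moves the witness to a rational time. No times lie to the right of \<open>T\<close>, so \<open>T\<close> has
  to be added to the countable set.
\<close>

lemma cadlag_witness_in_dense:
  assumes "cadlag T x" "u \<in> {0..T}" "\<bar>u - s\<bar> < r" "c < \<bar>x u - x s\<bar>"
  obtains q where "q \<in> (\<rat> \<inter> {0..T}) \<union> {T}" "\<bar>q - s\<bar> < r" "c < \<bar>x q - x s\<bar>"
proof (cases "u = T")
  case True
  then show ?thesis using assms that by blast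
next
  case False
  obtain \<eta> where \<eta>: "\<eta> > 0"
    "\<And>v. v \<in> {0..T} \<Longrightarrow> u \<le> v \<Longrightarrow> v < u + \<eta> \<Longrightarrow> \<bar>x v - x u\<bar> < \<bar>x u - x s\<bar> - c"
    using cadlag_one_sided_bounds[OF assms(1,2), of "\<bar>x u - x s\<bar> - c"] assms(4)
    by (metis diff_gt_0_iff_gt)
  have "u < min T (min (u + \<eta>) (s + r))"
    using False assms \<eta>(1) by auto
  then obtain q where q: "q \<in> \<rat>" "u < q" "q < min T (min (u + \<eta>) (s + r))"
    using Rats_dense_in_real by blast
  show ?thesis
    using \<eta>(2)[of q] q assms by (intro that[of q]) auto
qed

text \<open>
  Cadlag functions are bounded, so the infimum in the Skorokhod distance is over a nonempty set (the
  identity is an admissible time change) and every larger number is witnessed by a time change.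
\<close>

lemma skorokhod_dist_less_witness:
  assumes "cadlag T x" "cadlag T y" "T \<ge> 0" "skorokhod_dist T x y < \<delta>" "s \<in> {0..T}"
  obtains u where "u \<in> {0..T}" "\<bar>u - s\<bar> < \<delta>" "\<bar>x s - y u\<bar> < \<delta>"
proof -
  obtain C where C: "\<And>t. t \<in> {0..T} \<Longrightarrow> \<bar>x t\<bar> \<le> C"
    using cadlag_bounded[OF assms(1)] by blast
  obtain C' where C': "\<And>t. t \<in> {0..T} \<Longrightarrow> \<bar>y t\<bar> \<le> C'"
    using cadlag_bounded[OF assms(2)] by blast
  let ?S = "{\<epsilon>. \<epsilon> > 0 \<and> (\<exists>\<mu>\<in>time_changes T. \<forall>t\<in>{0..T}. \<bar>\<mu> t - t\<bar> \<le> \<epsilon> \<and> \<bar>x t - y (\<mu> t)\<bar> \<le> \<epsilon>)}"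
  have "\<bar>C\<bar> + \<bar>C'\<bar> + 1 \<in> ?S"
  proof -
    have "(\<lambda>t. t) \<in> time_changes T"
      unfolding time_changes_def by (auto intro!: strict_mono_onI)
    moreover have "\<bar>x t - y t\<bar> \<le> \<bar>C\<bar> + \<bar>C'\<bar> + 1" if "t \<in> {0..T}" for t
      using C[OF that] C'[OF that] by linarith
    ultimately show ?thesis by (auto intro!: bexI[of _ "\<lambda>t. t"])
  qed
  then have "?S \<noteq> {}" by blast
  then obtain e where e: "e \<in> ?S" "e < \<delta>"
    using cInf_lessD[of ?S \<delta>] assms(4) unfolding skorokhod_dist_def by blast
  then obtain \<mu> where \<mu>: "\<mu> \<in> time_changes T" "\<forall>t\<in>{0..T}. \<bar>\<mu> t - t\<bar> \<le> e \<and> \<bar>x t - y (\<mu> t)\<bar> \<le> e"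
    by blast
  have "\<mu> s \<in> {0..T}" using \<mu>(1) assms(5) unfolding time_changes_def by blast
  then show ?thesis
    using \<mu>(2) assms(5) e(2) by (intro that[of "\<mu> s"]) force+
qed

section \<open>Times at which the limit process is almost surely continuous\<close>

definition continuity_times :: "'a measure \<Rightarrow> real \<Rightarrow> (real \<Rightarrow> 'a \<Rightarrow> real) \<Rightarrow> real set" where
  "continuity_times M T X = {t \<in> {0..T}. AE \<omega> in M. jump (\<lambda>s. X s \<omega>) t = 0}"

lemma cadlag_processD:
  assumes "cadlag_process M T X"
  shows "t \<in> {0..T} \<Longrightarrow> X t \<in> borel_measurable M"
    and "\<omega> \<in> space M \<Longrightarrow> cadlag T (\<lambda>t. X t \<omega>)"
  using assms unfolding cadlag_process_def by auto

text \<open>The left limit is a limit along a sequence of deterministic times.\<close>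

lemma borel_measurable_jump:
  assumes "cadlag_process M T X" "t \<in> {0..T}"
  shows "(\<lambda>\<omega>. jump (\<lambda>s. X s \<omega>) t) \<in> borel_measurable M"
proof (cases "t = 0")
  case True
  then show ?thesis by (simp add: jump_def)
next
  case False
  then have t: "t \<in> {0<..T}" using assms(2) by auto
  define s where "s = (\<lambda>n. t - t / real (Suc n))"
  have s_mem: "s n \<in> {0..T}" "s n < t" for n
  proof -
    have "0 < t / real (Suc n)" "t / real (Suc n) \<le> t"
      using t by (auto simp: field_simps)
    then show "s n \<in> {0..T}" "s n < t"
      using t unfolding s_def by auto
  qed
  have "(\<lambda>n. t * inverse (real (Suc n))) \<longlonglongrightarrow> t * 0"
    by (intro tendsto_mult tendsto_const LIMSEQ_inverse_real_of_nat)
  then have "s \<longlonglongrightarrow> t - t * 0"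
    unfolding s_def by (intro tendsto_diff tendsto_const) (simp add: divide_inverse)
  then have s_lim: "filterlim s (at_left t) sequentially"
    using s_mem less_imp_neq unfolding filterlim_at by (auto intro!: always_eventually)
  have "(\<lambda>\<omega>. Lim (at_left t) (\<lambda>s. X s \<omega>)) \<in> borel_measurable M"
  proof (rule borel_measurable_LIMSEQ_real)
    show "(\<lambda>n. X (s n) \<omega>) \<longlonglongrightarrow> Lim (at_left t) (\<lambda>s. X s \<omega>)" if "\<omega> \<in> space M" for \<omega>
      using cadlag_tendsto_left[OF cadlag_processD(2)[OF assms(1) that] t] s_lim
      by (rule filterlim_compose)
    show "X (s n) \<in> borel_measurable M" for n
      using assms(1) s_mem by (intro cadlag_processD)
  qed
  with cadlag_processD(1)[OF assms] t show ?thesis by (simp add: jump_def)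
qed

text \<open>
  The times with a jump larger than \<open>\<delta>\<close> of probability larger than \<open>\<delta>\<close> are finite in number: along an
  infinite sequence of them, infinitely many of the jump events would occur together with positive
  probability, although a cadlag path has only finitely many jumps of that size.
\<close>

lemma (in prob_space) finite_times_of_likely_jumps:
  assumes X: "cadlag_process M T X" and "\<delta> > 0"
  shows "finite {t \<in> {0..T}. prob {\<omega> \<in> space M. \<bar>jump (\<lambda>s. X s \<omega>) t\<bar> > \<delta>} > \<delta>}"
    (is "finite ?S")
proof (rule ccontr)
  assume "infinite ?S"
  then obtain s :: "nat \<Rightarrow> real" where s: "inj s" "range s \<subseteq> ?S"
    using infinite_countable_subset by blast
  define J where "J n = {\<omega> \<in> space M. \<bar>jump (\<lambda>u. X u \<omega>) (s n)\<bar> > \<delta>}" for n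
  have [measurable]: "(\<lambda>\<omega>. jump (\<lambda>u. X u \<omega>) (s n)) \<in> borel_measurable M" for n
    using s(2) by (intro borel_measurable_jump[OF X]) auto
  have J[measurable]: "J n \<in> sets M" for n
    unfolding J_def by measurable
  have pJ: "prob (J n) > \<delta>" for n
    using s(2) unfolding J_def by auto
  define U where "U n = (\<Union>k\<in>{n..}. J k)" for n
  have U: "range U \<subseteq> sets M"
    unfolding U_def by auto
  have "decseq U"
    unfolding U_def decseq_def by fastforce
  then have "(\<lambda>n. prob (U n)) \<longlonglongrightarrow> prob (\<Inter>n. U n)"
    using U by (intro finite_Lim_measure_decseq)
  moreover have "\<delta> \<le> prob (U n)" for n
    using pJ[of n] finite_measure_mono[of "J n" "U n"] U unfolding U_def by fastforce
  ultimately have "\<delta> \<le> prob (\<Inter>n. U n)"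
    by (intro LIMSEQ_le_const) auto
  then have "(\<Inter>n. U n) \<noteq> {}"
    using \<open>\<delta> > 0\<close> by (metis measure_empty not_le)
  then obtain \<omega> where "\<And>n. \<omega> \<in> U n"
    by blast
  then have \<omega>: "\<exists>k\<ge>n. \<omega> \<in> J k" for n
    unfolding U_def by blast
  then have "infinite {k. \<omega> \<in> J k}"
    unfolding infinite_nat_iff_unbounded_le by auto
  then have "infinite (s ` {k. \<omega> \<in> J k})"
    using s(1) by (metis finite_imageD inj_on_subset subset_UNIV)
  moreover have "s ` {k. \<omega> \<in> J k} \<subseteq> {t \<in> {0..T}. \<bar>jump (\<lambda>u. X u \<omega>) t\<bar> > \<delta>}"
    using s(2) unfolding J_def by auto
  moreover have "\<omega> \<in> space M"
    using \<omega>[of 0] unfolding J_def by auto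
  ultimately show False
    using cadlag_finite_large_jumps[OF cadlag_processD(2)[OF X] \<open>\<delta> > 0\<close>] finite_subset by blast
qed

lemma (in prob_space) countable_fixed_discontinuities:
  assumes X: "cadlag_process M T X"
  shows "countable ({0..T} - continuity_times M T X)"
proof (rule countable_subset)
  let ?S = "\<lambda>n. {t \<in> {0..T}. prob {\<omega> \<in> space M. \<bar>jump (\<lambda>s. X s \<omega>) t\<bar> > 1 / real (Suc n)} > 1 / real (Suc n)}"
  have "finite (?S n)" for n
    by (rule finite_times_of_likely_jumps[OF X]) simp
  then show "countable (\<Union>n. ?S n)"
    by (simp add: countable_finite)
  show "{0..T} - continuity_times M T X \<subseteq> (\<Union>n. ?S n)"
  proof
    fix t assume "t \<in> {0..T} - continuity_times M T X"
    then have t: "t \<in> {0..T}" and nAE: "\<not> (AE \<omega> in M. jump (\<lambda>s. X s \<omega>) t = 0)"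
      unfolding continuity_times_def by auto
    have [measurable]: "(\<lambda>\<omega>. jump (\<lambda>s. X s \<omega>) t) \<in> borel_measurable M"
      by (rule borel_measurable_jump[OF X t])
    define A where "A n = {\<omega> \<in> space M. \<bar>jump (\<lambda>s. X s \<omega>) t\<bar> > 1 / real (Suc n)}" for n
    have A[measurable]: "A n \<in> sets M" for n
      unfolding A_def by measurable
    obtain m where m: "prob (A m) > 0"
    proof (rule ccontr)
      assume "\<not> thesis"
      then have "prob (A m) = 0" for m
        using that[of m] by (auto simp: zero_less_measure_iff)
      then have "AE \<omega> in M. \<omega> \<notin> A m" for m
        by (intro AE_not_in) (simp add: null_sets_def emeasure_eq_measure)
      then have "AE \<omega> in M. \<forall>m. \<omega> \<notin> A m"
        unfolding AE_all_countable by blast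
      then have "AE \<omega> in M. jump (\<lambda>s. X s \<omega>) t = 0"
        using AE_space
      proof eventually_elim
        case (elim \<omega>)
        show ?case
        proof (rule ccontr)
          assume "jump (\<lambda>s. X s \<omega>) t \<noteq> 0"
          then obtain m where "inverse (real (Suc m)) < \<bar>jump (\<lambda>s. X s \<omega>) t\<bar>"
            using reals_Archimedean by (metis zero_less_abs_iff)
          then show False
            using elim unfolding A_def by (auto simp: divide_inverse)
        qed
      qed
      then show False using nAE by blast
    qed
    then obtain k where k: "1 / real (Suc k) < prob (A m)"
      using reals_Archimedean by (metis inverse_eq_divide)
    let ?n = "max k m"
    have "1 / real (Suc ?n) \<le> 1 / real (Suc k)" "1 / real (Suc ?n) \<le> 1 / real (Suc m)"
      by (auto intro!: divide_left_mono)
    moreover have "prob (A m) \<le> prob (A ?n)"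
      using \<open>1 / real (Suc ?n) \<le> 1 / real (Suc m)\<close>
      by (intro finite_measure_mono A) (auto simp: A_def)
    ultimately have "t \<in> ?S ?n"
      using t k unfolding A_def by simp
    then show "t \<in> (\<Union>n. ?S n)" by blast
  qed
qed

lemma (in prob_space) continuity_times_dense:
  assumes X: "cadlag_process M T X" and "0 \<le> a" "a < b" "b \<le> T"
  obtains t where "t \<in> continuity_times M T X" "a < t" "t < b"
proof -
  have "\<not> {a<..<b} \<subseteq> {0..T} - continuity_times M T X"
    using countable_fixed_discontinuities[OF X] \<open>a < b\<close> countable_subset uncountable_open_interval
    by metis
  then show ?thesis
    using assms that by (auto simp: subset_eq)
qed

section \<open>Convergence in probability at fixed continuity times\<close>

definition converges_in_prob :: "'a measure \<Rightarrow> (nat \<Rightarrow> 'a \<Rightarrow> real) \<Rightarrow> ('a \<Rightarrow> real) \<Rightarrow> bool" where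
  "converges_in_prob M Y Z \<longleftrightarrow>
     (\<forall>\<delta>>0. \<forall>\<epsilon>>0. \<forall>\<^sub>F n in sequentially. measure M {\<omega> \<in> space M. \<delta> < \<bar>Y n \<omega> - Z \<omega>\<bar>} < \<epsilon>)"

text \<open>
  Almost every path of the limit is continuous at \<open>s\<close>, so with high probability it oscillates little
  on a short interval around \<open>s\<close>. A time change close to the identity therefore hardly affects the
  comparison of the values at \<open>s\<close>.
\<close>

lemma (in prob_space) skorokhod_converges_at_continuity_time:
  assumes X: "cadlag_process M T X" and Xs: "\<And>n. cadlag_process M T (Xs n)"
    and conv: "skorokhod_tendsto_in_prob M T Xs X"
    and s: "s \<in> continuity_times M T X"
  shows "converges_in_prob M (\<lambda>n. Xs n s) (X s)"
  unfolding converges_in_prob_def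
proof (intro allI impI)
  fix \<delta> \<epsilon> :: real assume "\<delta> > 0" "\<epsilon> > 0"
  have sT: "s \<in> {0..T}" and AEs: "AE \<omega> in M. jump (\<lambda>u. X u \<omega>) s = 0"
    using s unfolding continuity_times_def by auto
  \<comment> \<open>Countably many times witness the oscillation, which makes these events measurable.\<close>
  define Q where "Q = (\<rat> \<inter> {0..T}) \<union> {T}"
  have "countable Q" "Q \<subseteq> {0..T}"
    using sT countable_rat by (auto simp: Q_def)
  define E where "E k = (\<Union>q\<in>{q \<in> Q. \<bar>q - s\<bar> < 1 / real (Suc k)}.
      {\<omega> \<in> space M. \<delta> / 2 < \<bar>X q \<omega> - X s \<omega>\<bar>})" for k
  have [measurable]: "X s \<in> borel_measurable M" "Xs n s \<in> borel_measurable M" for n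
    using cadlag_processD[OF X] cadlag_processD[OF Xs] sT by blast+
  have E: "range E \<subseteq> sets M"
  proof -
    have "E k \<in> sets M" for k
      unfolding E_def
    proof (rule sets.countable_UN'')
      show "countable {q \<in> Q. \<bar>q - s\<bar> < 1 / real (Suc k)}"
        using \<open>countable Q\<close> by (rule countable_subset[rotated]) auto
      show "{\<omega> \<in> space M. \<delta> / 2 < \<bar>X q \<omega> - X s \<omega>\<bar>} \<in> sets M"
        if "q \<in> {q \<in> Q. \<bar>q - s\<bar> < 1 / real (Suc k)}" for q
      proof -
        have [measurable]: "X q \<in> borel_measurable M"
          using that \<open>Q \<subseteq> {0..T}\<close> by (intro cadlag_processD[OF X]) auto
        show ?thesis by measurable
      qed
    qed
    then show ?thesis by blast
  qed
  have "decseq E"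
  proof (rule decseq_SucI)
    fix k
    have "1 / real (Suc (Suc k)) \<le> 1 / real (Suc k)"
      by (intro divide_left_mono) auto
    then show "E (Suc k) \<le> E k"
      unfolding E_def by fastforce
  qed
  have "AE \<omega> in M. \<omega> \<notin> (\<Inter>k. E k)"
    using AEs AE_space
  proof eventually_elim
    case (elim \<omega>)
    then obtain \<eta> where \<eta>: "\<eta> > 0"
      "\<And>v. v \<in> {0..T} \<Longrightarrow> \<bar>v - s\<bar> < \<eta> \<Longrightarrow> \<bar>X v \<omega> - X s \<omega>\<bar> < \<delta> / 2"
      using cadlag_continuous_within_if_no_jump[OF cadlag_processD(2)[OF X] sT, of \<omega> "\<delta> / 2"]
        \<open>\<delta> > 0\<close> by (metis half_gt_zero)
    obtain k where "1 / real (Suc k) < \<eta>"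
      using reals_Archimedean[OF \<eta>(1)] by (auto simp: inverse_eq_divide)
    then have "\<omega> \<notin> E k"
      using \<eta>(2) \<open>Q \<subseteq> {0..T}\<close> unfolding E_def by force
    then show ?case by blast
  qed
  then have "prob (\<Inter>k. E k) = 0"
    using E by (subst prob_eq_0) auto
  then have "(\<lambda>k. prob (E k)) \<longlonglongrightarrow> 0"
    using finite_Lim_measure_decseq[OF E \<open>decseq E\<close>] by simp
  then have "\<forall>\<^sub>F k in sequentially. prob (E k) < \<epsilon> / 2"
    using \<open>\<epsilon> > 0\<close> by (intro order_tendstoD) auto
  then obtain k where k: "prob (E k) < \<epsilon> / 2"
    using eventually_happens by force
  define \<eta> where "\<eta> = min (1 / real (Suc k)) (\<delta> / 2)"
  have "\<eta> > 0" using \<open>\<delta> > 0\<close> by (simp add: \<eta>_def)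
  define B where "B n = {\<omega> \<in> space M. skorokhod_dist T (\<lambda>t. Xs n t \<omega>) (\<lambda>t. X t \<omega>) > \<eta> / 2}" for n
  have "(\<lambda>n. outer_measure_of M (B n)) \<longlonglongrightarrow> 0"
    using conv half_gt_zero[OF \<open>\<eta> > 0\<close>] unfolding skorokhod_tendsto_in_prob_def B_def by blast
  then have "\<forall>\<^sub>F n in sequentially. outer_measure_of M (B n) < ennreal (\<epsilon> / 2)"
    using \<open>\<epsilon> > 0\<close> by (intro order_tendstoD) auto
  then show "\<forall>\<^sub>F n in sequentially. prob {\<omega> \<in> space M. \<delta> < \<bar>Xs n s \<omega> - X s \<omega>\<bar>} < \<epsilon>"
  proof eventually_elim
    case (elim n)
    have "B n \<subseteq> space M" unfolding B_def by blast
    from outer_measure_of_attain[OF this] obtain A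
      where A: "A \<in> sets M" "B n \<subseteq> A" "outer_measure_of M (B n) = emeasure M A"
      by blast
    have pA: "prob A < \<epsilon> / 2"
      using elim \<open>\<epsilon> > 0\<close> unfolding A(3) by (simp add: emeasure_eq_measure ennreal_less_iff)
    have "{\<omega> \<in> space M. \<delta> < \<bar>Xs n s \<omega> - X s \<omega>\<bar>} \<subseteq> A \<union> E k"
    proof
      fix \<omega> assume \<omega>: "\<omega> \<in> {\<omega> \<in> space M. \<delta> < \<bar>Xs n s \<omega> - X s \<omega>\<bar>}"
      show "\<omega> \<in> A \<union> E k"
      proof (cases "\<omega> \<in> B n")
        case True
        then show ?thesis using A by blast
      next
        case False
        have path: "cadlag T (\<lambda>t. Xs n t \<omega>)" "cadlag T (\<lambda>t. X t \<omega>)"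
          using \<omega> cadlag_processD(2)[OF X] cadlag_processD(2)[OF Xs] by auto
        have "skorokhod_dist T (\<lambda>t. Xs n t \<omega>) (\<lambda>t. X t \<omega>) < \<eta>"
          using False \<omega> \<open>\<eta> > 0\<close> unfolding B_def by auto
        then obtain u where u: "u \<in> {0..T}" "\<bar>u - s\<bar> < \<eta>" "\<bar>Xs n s \<omega> - X u \<omega>\<bar> < \<eta>"
          using skorokhod_dist_less_witness[OF path, of \<eta> s] sT by auto
        have "\<bar>Xs n s \<omega> - X u \<omega>\<bar> < \<delta> / 2" "\<delta> < \<bar>Xs n s \<omega> - X s \<omega>\<bar>"
          using u \<omega> unfolding \<eta>_def by auto
        then have "\<delta> / 2 < \<bar>X u \<omega> - X s \<omega>\<bar>"
          by linarith
        moreover have "\<bar>u - s\<bar> < 1 / real (Suc k)"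
          using u unfolding \<eta>_def by auto
        ultimately obtain q where "q \<in> Q" "\<bar>q - s\<bar> < 1 / real (Suc k)" "\<delta> / 2 < \<bar>X q \<omega> - X s \<omega>\<bar>"
          using cadlag_witness_in_dense[OF path(2) u(1), of s] unfolding Q_def by blast
        then show ?thesis using \<omega> unfolding E_def by blast
      qed
    qed
    then have "prob {\<omega> \<in> space M. \<delta> < \<bar>Xs n s \<omega> - X s \<omega>\<bar>} \<le> prob (A \<union> E k)"
      using A E by (intro finite_measure_mono) auto
    also have "\<dots> \<le> prob A + prob (E k)"
      using A E by (intro measure_Un_le) auto
    finally show ?case using pA k by simp
  qed
qed

text \<open>
  With high probability \<open>Z\<close> stays in a compact interval, on a neighbourhood of which \<open>g\<close> is uniformly
  continuous.
\<close>

lemma (in prob_space) converges_in_prob_continuous: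
  fixes g :: "real \<Rightarrow> real"
  assumes [measurable]: "\<And>n. Y n \<in> borel_measurable M" "Z \<in> borel_measurable M"
    and conv: "converges_in_prob M Y Z" and g: "continuous_on UNIV g"
  shows "converges_in_prob M (\<lambda>n \<omega>. g (Y n \<omega>)) (\<lambda>\<omega>. g (Z \<omega>))"
  unfolding converges_in_prob_def
proof (intro allI impI)
  fix \<delta> \<epsilon> :: real assume "\<delta> > 0" "\<epsilon> > 0"
  have [measurable]: "g \<in> borel_measurable borel"
    using g by (rule borel_measurable_continuous_onI)
  define E where "E k = {\<omega> \<in> space M. real k < \<bar>Z \<omega>\<bar>}" for k
  have E: "range E \<subseteq> sets M"
    unfolding E_def by auto
  have "decseq E"
    unfolding E_def decseq_def by fastforce
  moreover have "(\<Inter>k. E k) = {}"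
  proof -
    have "\<exists>k. \<omega> \<notin> E k" for \<omega>
    proof -
      obtain k where "\<bar>Z \<omega>\<bar> < real k"
        using reals_Archimedean2 by blast
      then have "\<omega> \<notin> E k" by (simp add: E_def)
      then show ?thesis by blast
    qed
    then show ?thesis by blast
  qed
  ultimately have "(\<lambda>k. prob (E k)) \<longlonglongrightarrow> 0"
    using finite_Lim_measure_decseq[OF E] by simp
  then have "\<forall>\<^sub>F k in sequentially. prob (E k) < \<epsilon> / 2"
    using \<open>\<epsilon> > 0\<close> by (intro order_tendstoD) auto
  then obtain k where k: "prob (E k) < \<epsilon> / 2"
    using eventually_happens by force
  have "uniformly_continuous_on {- real k - 1..real k + 1} g"
    by (intro compact_uniformly_continuous continuous_on_subset[OF g]) auto
  then obtain \<eta> where "\<eta> > 0" and \<eta>: "\<forall>y\<in>{- real k - 1..real k + 1}. \<forall>z\<in>{- real k - 1..real k + 1}.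
      dist z y < \<eta> \<longrightarrow> dist (g z) (g y) < \<delta>"
    using \<open>\<delta> > 0\<close> unfolding uniformly_continuous_on_def by blast
  define r where "r = min (\<eta> / 2) 1"
  have "r > 0" using \<open>\<eta> > 0\<close> by (simp add: r_def)
  then have "\<forall>\<^sub>F n in sequentially. prob {\<omega> \<in> space M. r < \<bar>Y n \<omega> - Z \<omega>\<bar>} < \<epsilon> / 2"
    using conv[unfolded converges_in_prob_def, rule_format, of r "\<epsilon> / 2"] \<open>\<epsilon> > 0\<close> by simp
  then show "\<forall>\<^sub>F n in sequentially. prob {\<omega> \<in> space M. \<delta> < \<bar>g (Y n \<omega>) - g (Z \<omega>)\<bar>} < \<epsilon>"
  proof eventually_elim
    case (elim n)
    have "{\<omega> \<in> space M. \<delta> < \<bar>g (Y n \<omega>) - g (Z \<omega>)\<bar>} \<subseteq> {\<omega> \<in> space M. r < \<bar>Y n \<omega> - Z \<omega>\<bar>} \<union> E k"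
    proof
      fix \<omega> assume \<omega>: "\<omega> \<in> {\<omega> \<in> space M. \<delta> < \<bar>g (Y n \<omega>) - g (Z \<omega>)\<bar>}"
      show "\<omega> \<in> {\<omega> \<in> space M. r < \<bar>Y n \<omega> - Z \<omega>\<bar>} \<union> E k"
      proof (rule ccontr)
        assume "\<omega> \<notin> {\<omega> \<in> space M. r < \<bar>Y n \<omega> - Z \<omega>\<bar>} \<union> E k"
        then have close: "\<bar>Y n \<omega> - Z \<omega>\<bar> \<le> r" "\<bar>Z \<omega>\<bar> \<le> real k"
          using \<omega> unfolding E_def by auto
        have "r < \<eta>" "r \<le> 1"
          using \<open>\<eta> > 0\<close> by (auto simp: r_def)
        with close have "Z \<omega> \<in> {- real k - 1..real k + 1}" "Y n \<omega> \<in> {- real k - 1..real k + 1}"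
          "dist (Y n \<omega>) (Z \<omega>) < \<eta>"
          by (auto simp: dist_real_def)
        then have "\<bar>g (Y n \<omega>) - g (Z \<omega>)\<bar> < \<delta>"
          using \<eta>[rule_format, of "Z \<omega>" "Y n \<omega>"] by (simp add: dist_real_def)
        then show False using \<omega> by auto
      qed
    qed
    then have "prob {\<omega> \<in> space M. \<delta> < \<bar>g (Y n \<omega>) - g (Z \<omega>)\<bar>}
        \<le> prob ({\<omega> \<in> space M. r < \<bar>Y n \<omega> - Z \<omega>\<bar>} \<union> E k)"
      using E by (intro finite_measure_mono sets.Un) auto
    also have "\<dots> \<le> prob {\<omega> \<in> space M. r < \<bar>Y n \<omega> - Z \<omega>\<bar>} + prob (E k)"
      using E by (intro measure_Un_le) auto
    finally show ?case using elim k by simp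
  qed
qed

section \<open>Natural filtrations and stopping times with finitely many values\<close>

lemma sets_natural_filtration:
  "sets (natural_filtration M T X t) =
     sigma_sets (space M) {X s -` B \<inter> space M | s B. s \<in> {0..T} \<and> s \<le> t \<and> B \<in> sets borel}"
  unfolding natural_filtration_def by (rule sets_measure_of) auto

lemma sets_natural_filtration_subset:
  assumes "\<And>t. t \<in> {0..T} \<Longrightarrow> X t \<in> borel_measurable M"
  shows "sets (natural_filtration M T X t) \<subseteq> sets M"
  unfolding sets_natural_filtration using assms by (intro sets.sigma_sets_subset) auto

lemma borel_measurable_natural_filtration:
  assumes "s \<in> {0..T}" "s \<le> t"
  shows "X s \<in> borel_measurable (natural_filtration M T X t)"
proof (rule measurableI)
  show "X s -` B \<inter> space (natural_filtration M T X t) \<in> sets (natural_filtration M T X t)"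
    if "B \<in> sets borel" for B
    using assms that unfolding sets_natural_filtration space_natural_filtration
    by (intro sigma_sets.Basic) blast
qed simp

lemma stopping_times_uptoD:
  assumes "\<tau> \<in> stopping_times_upto M (natural_filtration M T X) L"
  shows "\<omega> \<in> space M \<Longrightarrow> \<tau> \<omega> \<in> {0..L}"
    and "{\<omega> \<in> space M. \<tau> \<omega> \<le> t} \<in> sets (natural_filtration M T X t)"
  using assms unfolding stopping_times_upto_def stopping_time_def pred_def by auto

lemma borel_measurable_stopping_times_upto:
  assumes "cadlag_process M T X" "\<tau> \<in> stopping_times_upto M (natural_filtration M T X) L"
  shows "\<tau> \<in> borel_measurable M"
  unfolding borel_measurable_iff_le
  using stopping_times_uptoD(2)[OF assms(2)]
    sets_natural_filtration_subset[of T X M, OF cadlag_processD(1)[OF assms(1)]] by blast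

text \<open>The value \<open>L\<close> is a deadline, for the case that no time of \<open>P\<close> is accepted earlier.\<close>

definition first_accepted :: "real set \<Rightarrow> real \<Rightarrow> (real \<Rightarrow> bool) \<Rightarrow> real" where
  "first_accepted P L Q = Min (insert L {p \<in> P. Q p})"

lemma first_accepted_mem:
  assumes "finite P"
  shows "first_accepted P L Q \<in> insert L P"
proof -
  have "first_accepted P L Q \<in> insert L {p \<in> P. Q p}"
    unfolding first_accepted_def using assms by (intro Min_in) auto
  then show ?thesis by blast
qed

lemma first_accepted_le_iff:
  assumes "finite P"
  shows "first_accepted P L Q \<le> u \<longleftrightarrow> L \<le> u \<or> (\<exists>p\<in>P. Q p \<and> p \<le> u)"
  unfolding first_accepted_def using assms by (subst Min_le_iff) auto

lemma first_accepted_ge: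
  assumes "finite P" "t \<le> L"
  shows "t \<le> first_accepted P L (\<lambda>p. t \<le> p)"
  unfolding first_accepted_def using assms by (subst Min_ge_iff) auto

lemma first_accepted_eq:
  assumes "finite P" "t \<in> P" "t \<le> L"
  shows "first_accepted P L (\<lambda>p. t \<le> p) = t"
  using first_accepted_ge[OF assms(1,3)] first_accepted_le_iff[OF assms(1), of L "\<lambda>p. t \<le> p" t] assms(2)
  by auto

text \<open>
  This serves twice: to round a stopping time up to a finite set of times, and to turn approximations
  of the events \<open>\<tau> \<le> p\<close>, which need not be nested, into a genuine stopping time.
\<close>

lemma first_accepted_stopping_time:
  assumes "finite P" "P \<subseteq> {0..L}" "0 \<le> L"
    and Q: "\<And>p. p \<in> P \<Longrightarrow> {\<omega> \<in> space M. Q \<omega> p} \<in> sets (natural_filtration M T X p)"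
  shows "(\<lambda>\<omega>. first_accepted P L (Q \<omega>)) \<in> stopping_times_upto M (natural_filtration M T X) L"
proof -
  interpret filtration "space M" "natural_filtration M T X"
    by (rule filtration_natural_filtration)
  have "{\<omega> \<in> space M. first_accepted P L (Q \<omega>) \<le> t} \<in> sets (natural_filtration M T X t)" for t
  proof (cases "L \<le> t")
    case True
    then have "{\<omega> \<in> space M. first_accepted P L (Q \<omega>) \<le> t} = space (natural_filtration M T X t)"
      using assms(1) by (auto simp: first_accepted_le_iff)
    then show ?thesis by (metis sets.top)
  next
    case False
    then have "{\<omega> \<in> space M. first_accepted P L (Q \<omega>) \<le> t}
        = (\<Union>p\<in>{p \<in> P. p \<le> t}. {\<omega> \<in> space M. Q \<omega> p})"
      using assms(1) by (auto simp: first_accepted_le_iff)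
    also have "\<dots> \<in> sets (natural_filtration M T X t)"
      using assms(1) Q sets_F_mono by (intro sets.finite_UN) auto
    finally show ?thesis .
  qed
  moreover have "first_accepted P L (Q \<omega>) \<in> {0..L}" for \<omega>
    using first_accepted_mem[OF assms(1), of L "Q \<omega>"] assms(2,3) by auto
  ultimately show ?thesis
    unfolding stopping_times_upto_def stopping_time_def pred_def by auto
qed

lemma borel_measurable_at_finitely_many_times:
  fixes X :: "real \<Rightarrow> 'a \<Rightarrow> real"
  assumes \<sigma>: "\<sigma> \<in> borel_measurable M" and "finite P" "\<And>\<omega>. \<omega> \<in> space M \<Longrightarrow> \<sigma> \<omega> \<in> P"
    and X: "\<And>p. p \<in> P \<Longrightarrow> X p \<in> borel_measurable M"
  shows "(\<lambda>\<omega>. X (\<sigma> \<omega>) \<omega>) \<in> borel_measurable M"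
proof -
  have "X (\<sigma> \<omega>) \<omega> = (\<Sum>p\<in>P. if \<sigma> \<omega> = p then X p \<omega> else 0)" if "\<omega> \<in> space M" for \<omega>
    using assms(2,3) that by simp
  moreover have "(\<lambda>\<omega>. \<Sum>p\<in>P. if \<sigma> \<omega> = p then X p \<omega> else 0) \<in> borel_measurable M"
  proof (intro borel_measurable_sum measurable_If)
    show "{\<omega> \<in> space M. \<sigma> \<omega> = p} \<in> sets M" for p
      by (rule borel_measurable_eq[OF \<sigma> borel_measurable_const])
  qed (use X in auto)
  ultimately show ?thesis
    by (subst measurable_cong) auto
qed

lemma finite_grids_in_dense_set:
  assumes dense: "\<And>a b. 0 \<le> a \<Longrightarrow> a < b \<Longrightarrow> b \<le> L \<Longrightarrow> \<exists>t\<in>D. a < t \<and> t < b"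
  obtains P :: "nat \<Rightarrow> real set"
  where "\<And>k. finite (P k)" "\<And>k. P k \<subseteq> D \<inter> {0..L}"
    "\<And>t. t \<in> {0..L} \<Longrightarrow> (\<lambda>k. first_accepted (P k) L (\<lambda>p. t \<le> p)) \<longlonglongrightarrow> t"
proof (cases "L > 0")
  case False
  have "(\<lambda>k. first_accepted {} L (\<lambda>p. t \<le> p)) \<longlonglongrightarrow> t" if "t \<in> {0..L}" for t
  proof -
    have "t = L" using that False by auto
    then show ?thesis by (simp add: first_accepted_def)
  qed
  then show ?thesis by (intro that[of "\<lambda>_. {}"]) auto
next
  case True
  obtain d where d: "\<And>a b. 0 \<le> a \<Longrightarrow> a < b \<Longrightarrow> b \<le> L \<Longrightarrow> d a b \<in> D \<and> a < d a b \<and> d a b < b"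
    using dense by metis
  \<comment> \<open>Choosing one point of \<open>D\<close> between any two rationals gives a countable set that is still dense.\<close>
  define I where "I = {(a, b). a \<in> \<rat> \<and> b \<in> \<rat> \<and> 0 \<le> a \<and> a < b \<and> b \<le> L}"
  define C where "C = (\<lambda>(a, b). d a b) ` I"
  have "countable (\<rat> \<times> \<rat> :: (real \<times> real) set)"
    using countable_rat by (intro countable_SIGMA) auto
  then have "countable I"
    by (rule countable_subset[rotated]) (auto simp: I_def)
  then have "countable C"
    unfolding C_def by (rule countable_image)
  have "C \<subseteq> D \<inter> {0..L}"
  proof
    fix p assume "p \<in> C"
    then obtain a b where "p = d a b" "0 \<le> a" "a < b" "b \<le> L"
      unfolding C_def I_def by auto
    then show "p \<in> D \<inter> {0..L}"
      using d[of a b] by auto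
  qed
  have C_dense: "\<exists>p\<in>C. a < p \<and> p < b" if ab: "0 \<le> a" "a < b" "b \<le> L" for a b
  proof -
    obtain q where q: "q \<in> \<rat>" "a < q" "q < b"
      using Rats_dense_in_real ab by blast
    obtain r where r: "r \<in> \<rat>" "q < r" "r < b"
      using Rats_dense_in_real q by blast
    have "(q, r) \<in> I"
      using q r ab unfolding I_def by auto
    then have "d q r \<in> C"
      unfolding C_def by force
    then show ?thesis
      using d[of q r] q r ab by (intro bexI[of _ "d q r"]) auto
  qed
  then have "C \<noteq> {}"
    using True by blast
  define e where "e = from_nat_into C"
  have e: "range e = C"
    unfolding e_def using \<open>C \<noteq> {}\<close> \<open>countable C\<close> by (rule range_from_nat_into)
  define P where "P k = e ` {..k}" for k
  have P_fin: "finite (P k)" for k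
    unfolding P_def by simp
  have "(\<lambda>k. first_accepted (P k) L (\<lambda>p. t \<le> p)) \<longlonglongrightarrow> t" if t: "t \<in> {0..L}" for t
  proof (rule LIMSEQ_I)
    fix r :: real assume "r > 0"
    have "\<exists>N. \<forall>k\<ge>N. first_accepted (P k) L (\<lambda>p. t \<le> p) < t + r"
    proof (cases "t = L")
      case True
      have "first_accepted (P k) L (\<lambda>p. t \<le> p) \<le> L" for k
        using first_accepted_le_iff[OF P_fin] by blast
      then have "first_accepted (P k) L (\<lambda>p. t \<le> p) < t + r" for k
        using \<open>r > 0\<close> True by (metis less_add_same_cancel1 le_less_trans)
      then show ?thesis by blast
    next
      case False
      then obtain p where p: "p \<in> C" "t < p" "p < min L (t + r)"
        using C_dense[of t "min L (t + r)"] t \<open>r > 0\<close> by auto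
      then obtain j where j: "p = e j"
        using e by blast
      have "first_accepted (P k) L (\<lambda>p. t \<le> p) \<le> p" if "k \<ge> j" for k
      proof -
        have "p \<in> P k" using that j by (auto simp: P_def)
        then show ?thesis
          using less_imp_le[OF p(2)] unfolding first_accepted_le_iff[OF P_fin] by blast
      qed
      then show ?thesis using p(3) by (intro exI[of _ j]) force
    qed
    then show "\<exists>N. \<forall>k\<ge>N. norm (first_accepted (P k) L (\<lambda>p. t \<le> p) - t) < r"
    proof (elim exE, intro exI allI impI)
      fix N k assume "\<forall>k\<ge>N. first_accepted (P k) L (\<lambda>p. t \<le> p) < t + r" "N \<le> k"
      then have "first_accepted (P k) L (\<lambda>p. t \<le> p) < t + r"
        by blast
      moreover have "t \<le> first_accepted (P k) L (\<lambda>p. t \<le> p)"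
        using t by (intro first_accepted_ge P_fin) auto
      ultimately show "norm (first_accepted (P k) L (\<lambda>p. t \<le> p) - t) < r"
        by simp
    qed
  qed
  moreover have "P k \<subseteq> D \<inter> {0..L}" for k
    using e \<open>C \<subseteq> D \<inter> {0..L}\<close> unfolding P_def by blast
  ultimately show ?thesis
    using P_fin by (intro that)
qed

text \<open>
  The function \<open>\<gamma>\<close> is controlled only on the half-space of nonnegative times, so it is cut off outside.
\<close>

lemma borel_measurable_reward:
  assumes \<gamma>: "continuous_on ({0..} \<times> UNIV) (\<gamma> :: real \<times> real \<Rightarrow> real)"
    and [measurable]: "\<tau> \<in> borel_measurable M" "Z \<in> borel_measurable M"
    and nonneg: "\<And>\<omega>. \<omega> \<in> space M \<Longrightarrow> 0 \<le> \<tau> \<omega>"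
  shows "(\<lambda>\<omega>. \<gamma> (\<tau> \<omega>, Z \<omega>)) \<in> borel_measurable M"
proof -
  have "{0..} \<times> UNIV \<in> sets (borel :: (real \<times> real) measure)"
    by (intro borel_closed closed_Times) auto
  from borel_measurable_continuous_on_indicator[OF this \<gamma>]
  have "(\<lambda>\<omega>. indicator ({0..} \<times> UNIV) (\<tau> \<omega>, Z \<omega>) *\<^sub>R \<gamma> (\<tau> \<omega>, Z \<omega>)) \<in> borel_measurable M"
    by (rule measurable_compose[rotated]) measurable
  then show ?thesis
    by (rule measurable_cong[THEN iffD1, rotated]) (simp add: nonneg)
qed

text \<open>
  Rounding up moves a stopping time to the right, where the path is continuous; dominated convergence
  then carries the convergence of the rewards over to the expectations.
\<close>

lemma (in prob_space) expectation_rounded_up_tendsto: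
  assumes X: "cadlag_process M T X" and L: "L \<in> {0..T}"
    and \<gamma>: "continuous_on ({0..} \<times> UNIV) (\<gamma> :: real \<times> real \<Rightarrow> real)"
    and C: "\<And>t x. 0 \<le> t \<Longrightarrow> \<bar>\<gamma> (t, x)\<bar> \<le> C"
    and \<tau>: "\<tau> \<in> stopping_times_upto M (natural_filtration M T X) L"
    and P: "\<And>k. finite (P k)" "\<And>k. P k \<subseteq> {0..L}"
      "\<And>t. t \<in> {0..L} \<Longrightarrow> (\<lambda>k. first_accepted (P k) L (\<lambda>p. t \<le> p)) \<longlonglongrightarrow> t"
  defines "\<sigma> \<equiv> \<lambda>k \<omega>. first_accepted (P k) L (\<lambda>p. \<tau> \<omega> \<le> p)"
  shows "\<sigma> k \<in> stopping_times_upto M (natural_filtration M T X) L"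
    and "(\<lambda>k. expectation (\<lambda>\<omega>. \<gamma> (\<sigma> k \<omega>, X (\<sigma> k \<omega>) \<omega>)))
      \<longlonglongrightarrow> expectation (\<lambda>\<omega>. \<gamma> (\<tau> \<omega>, X (\<tau> \<omega>) \<omega>))"
proof -
  note \<tau>_le = stopping_times_uptoD(1)[OF \<tau>]
  have \<tau>_meas: "\<tau> \<in> borel_measurable M"
    using X \<tau> by (rule borel_measurable_stopping_times_upto)
  have \<sigma>: "\<sigma> k \<in> stopping_times_upto M (natural_filtration M T X) L" for k
    unfolding \<sigma>_def using P L stopping_times_uptoD(2)[OF \<tau>]
    by (intro first_accepted_stopping_time) auto
  then show "\<sigma> k \<in> stopping_times_upto M (natural_filtration M T X) L" .
  have \<sigma>_meas: "\<sigma> k \<in> borel_measurable M" for k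
    using X \<sigma> by (rule borel_measurable_stopping_times_upto)
  note \<sigma>_le = stopping_times_uptoD(1)[OF \<sigma>]
  have X\<sigma>_meas: "(\<lambda>\<omega>. X (\<sigma> k \<omega>) \<omega>) \<in> borel_measurable M" for k
  proof (rule borel_measurable_at_finitely_many_times[OF \<sigma>_meas])
    show "finite (insert L (P k))"
      using P by simp
    show "\<sigma> k \<omega> \<in> insert L (P k)" for \<omega>
      unfolding \<sigma>_def using P(1) by (rule first_accepted_mem)
    show "X p \<in> borel_measurable M" if "p \<in> insert L (P k)" for p
      using that P(2)[of k] L by (intro cadlag_processD(1)[OF X]) auto
  qed
  have lim: "(\<lambda>k. \<sigma> k \<omega>) \<longlonglongrightarrow> \<tau> \<omega>" if "\<omega> \<in> space M" for \<omega>
    unfolding \<sigma>_def using \<tau>_le[OF that] by (rule P(3))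
  have X_lim: "(\<lambda>k. X (\<sigma> k \<omega>) \<omega>) \<longlonglongrightarrow> X (\<tau> \<omega>) \<omega>" if \<omega>: "\<omega> \<in> space M" for \<omega>
  proof -
    have "continuous (at (\<tau> \<omega>) within {\<tau> \<omega>..T}) (\<lambda>t. X t \<omega>)"
      using cadlag_processD(2)[OF X \<omega>] \<tau>_le[OF \<omega>] L unfolding cadlag_def by auto
    moreover have "\<sigma> k \<omega> \<in> {\<tau> \<omega>..T}" for k
      using \<sigma>_le[OF \<omega>, of k] first_accepted_ge[OF P(1), of "\<tau> \<omega>" L k] \<tau>_le[OF \<omega>] L
      unfolding \<sigma>_def by auto
    ultimately show ?thesis
      using lim[OF \<omega>] unfolding continuous_within_sequentially by (auto simp: comp_def)
  qed
  have X\<tau>_meas: "(\<lambda>\<omega>. X (\<tau> \<omega>) \<omega>) \<in> borel_measurable M"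
    using X_lim X\<sigma>_meas by (rule borel_measurable_LIMSEQ_real)
  show "(\<lambda>k. expectation (\<lambda>\<omega>. \<gamma> (\<sigma> k \<omega>, X (\<sigma> k \<omega>) \<omega>)))
      \<longlonglongrightarrow> expectation (\<lambda>\<omega>. \<gamma> (\<tau> \<omega>, X (\<tau> \<omega>) \<omega>))"
  proof (rule integral_dominated_convergence)
    show "(\<lambda>\<omega>. \<gamma> (\<tau> \<omega>, X (\<tau> \<omega>) \<omega>)) \<in> borel_measurable M"
      using \<gamma> \<tau>_meas X\<tau>_meas by (rule borel_measurable_reward) (use \<tau>_le in auto)
    show "(\<lambda>\<omega>. \<gamma> (\<sigma> k \<omega>, X (\<sigma> k \<omega>) \<omega>)) \<in> borel_measurable M" for k
      using \<gamma> \<sigma>_meas X\<sigma>_meas by (rule borel_measurable_reward) (use \<sigma>_le in auto)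
    show "integrable M (\<lambda>_. C)" by simp
    show "AE \<omega> in M. norm (\<gamma> (\<sigma> k \<omega>, X (\<sigma> k \<omega>) \<omega>)) \<le> C" for k
      using \<sigma>_le[of _ k] C by (intro AE_I2) auto
    show "AE \<omega> in M. (\<lambda>k. \<gamma> (\<sigma> k \<omega>, X (\<sigma> k \<omega>) \<omega>)) \<longlonglongrightarrow> \<gamma> (\<tau> \<omega>, X (\<tau> \<omega>) \<omega>)"
    proof (rule AE_I2)
      fix \<omega> assume \<omega>: "\<omega> \<in> space M"
      show "(\<lambda>k. \<gamma> (\<sigma> k \<omega>, X (\<sigma> k \<omega>) \<omega>)) \<longlonglongrightarrow> \<gamma> (\<tau> \<omega>, X (\<tau> \<omega>) \<omega>)"
        using \<tau>_le[OF \<omega>] \<sigma>_le[OF \<omega>]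
        by (intro continuous_on_tendsto_compose[OF \<gamma>] tendsto_Pair lim X_lim \<omega>) auto
    qed
  qed
qed

section \<open>Approximation of events along a sequence of sigma-algebras\<close>

definition approximable_sets :: "'a measure \<Rightarrow> (nat \<Rightarrow> 'a set set) \<Rightarrow> 'a set set" where
  "approximable_sets M G =
     {A \<in> sets M. \<forall>\<epsilon>>0. \<forall>\<^sub>F n in sequentially. \<exists>B\<in>G n. measure M (sym_diff A B) < \<epsilon>}"

text \<open>
  Being a sigma-algebra is what makes this class useful: approximability has to be checked on
  generators only. Countable unions are exhausted by finite ones.
\<close>

lemma (in prob_space) sigma_algebra_approximable_sets:
  assumes G: "\<And>n. sigma_algebra (space M) (G n)" and sub: "\<And>n. G n \<subseteq> sets M"
  shows "sigma_algebra (space M) (approximable_sets M G)"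
  unfolding sigma_algebra_iff2
proof (intro conjI ballI allI impI)
  show "approximable_sets M G \<subseteq> Pow (space M)"
    unfolding approximable_sets_def using sets.sets_into_space by auto
  have "{} \<in> G n" for n
    using G[of n] by (simp add: sigma_algebra_iff2)
  then have "\<exists>B\<in>G n. prob (sym_diff {} B) < \<epsilon>" if "\<epsilon> > 0" for n and \<epsilon> :: real
    using that by (intro bexI[of _ "{}"]) auto
  then show "{} \<in> approximable_sets M G"
    unfolding approximable_sets_def by auto
next
  fix A assume A: "A \<in> approximable_sets M G"
  have "\<exists>B'\<in>G n. prob (sym_diff (space M - A) B') < \<epsilon>"
    if B: "B \<in> G n" "prob (sym_diff A B) < \<epsilon>" for n B \<epsilon>
  proof
    show "space M - B \<in> G n"
      using G[of n] B by (simp add: sigma_algebra_iff2)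
    have "A \<subseteq> space M" "B \<subseteq> space M"
      using A B sub[of n] sets.sets_into_space unfolding approximable_sets_def by auto
    then have "sym_diff (space M - A) (space M - B) = sym_diff A B"
      by blast
    then show "prob (sym_diff (space M - A) (space M - B)) < \<epsilon>"
      using B by simp
  qed
  then show "space M - A \<in> approximable_sets M G"
    using A unfolding approximable_sets_def by (fastforce elim: eventually_mono)
next
  fix A :: "nat \<Rightarrow> 'a set" assume A: "range A \<subseteq> approximable_sets M G"
  have Asets: "A i \<in> sets M" for i
    using A unfolding approximable_sets_def by auto
  show "(\<Union>i. A i) \<in> approximable_sets M G"
    unfolding approximable_sets_def
  proof (intro CollectI conjI allI impI)
    show "(\<Union>i. A i) \<in> sets M"
      using Asets by auto
    fix \<epsilon> :: real assume "\<epsilon> > 0"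
    \<comment> \<open>Finitely many of the sets exhaust the union up to half of the admissible error.\<close>
    define R where "R K = (\<Union>i. A i) - (\<Union>i<K. A i)" for K :: nat
    have R: "range R \<subseteq> sets M"
      unfolding R_def using Asets by auto
    have "decseq R"
      unfolding R_def decseq_def by fastforce
    moreover have "(\<Inter>K. R K) = {}"
      unfolding R_def by auto
    ultimately have "(\<lambda>K. prob (R K)) \<longlonglongrightarrow> 0"
      using finite_Lim_measure_decseq[OF R] by simp
    then have "\<forall>\<^sub>F K in sequentially. prob (R K) < \<epsilon> / 2"
      using \<open>\<epsilon> > 0\<close> by (intro order_tendstoD) auto
    then obtain K where K: "prob (R K) < \<epsilon> / 2"
      using eventually_happens by force
    define \<kappa> where "\<kappa> = \<epsilon> / (2 * real (Suc K))"
    have "\<kappa> > 0" using \<open>\<epsilon> > 0\<close> by (simp add: \<kappa>_def)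
    have "real K * \<kappa> \<le> real (Suc K) * \<kappa>"
      using \<open>\<kappa> > 0\<close> by simp
    also have "\<dots> = \<epsilon> / 2"
      by (simp add: \<kappa>_def del: of_nat_Suc)
    finally have K\<kappa>: "real K * \<kappa> \<le> \<epsilon> / 2" .
    have "\<forall>\<^sub>F n in sequentially. \<exists>B\<in>G n. prob (sym_diff (A i) B) < \<kappa>" for i
      using A \<open>\<kappa> > 0\<close> unfolding approximable_sets_def by auto
    then have "\<forall>\<^sub>F n in sequentially. \<forall>i\<in>{..<K}. \<exists>B\<in>G n. prob (sym_diff (A i) B) < \<kappa>"
      by (intro eventually_ball_finite) auto
    then show "\<forall>\<^sub>F n in sequentially. \<exists>B\<in>G n. prob (sym_diff (\<Union>i. A i) B) < \<epsilon>"
    proof eventually_elim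
      case (elim n)
      then obtain B where B: "\<And>i. i < K \<Longrightarrow> B i \<in> G n" "\<And>i. i < K \<Longrightarrow> prob (sym_diff (A i) (B i)) < \<kappa>"
        by (metis lessThan_iff)
      interpret G: sigma_algebra "space M" "G n" by (rule G)
      have Bsets: "B i \<in> sets M" if "i < K" for i
        using B(1)[OF that] sub by blast
      have "(\<Union>i<K. B i) \<in> G n"
        using B(1) by (intro G.finite_UN) auto
      moreover have "prob (sym_diff (\<Union>i. A i) (\<Union>i<K. B i)) < \<epsilon>"
      proof -
        have meas: "(\<Union>i<K. sym_diff (A i) (B i)) \<in> sets M"
          using Asets Bsets by (intro sets.finite_UN) auto
        have "prob (sym_diff (\<Union>i. A i) (\<Union>i<K. B i)) \<le> prob (R K \<union> (\<Union>i<K. sym_diff (A i) (B i)))"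
          using R meas by (intro finite_measure_mono) (auto simp: R_def)
        also have "\<dots> \<le> prob (R K) + prob (\<Union>i<K. sym_diff (A i) (B i))"
          using R meas by (intro measure_Un_le) auto
        also have "prob (\<Union>i<K. sym_diff (A i) (B i)) \<le> (\<Sum>i<K. prob (sym_diff (A i) (B i)))"
          using Asets Bsets by (intro finite_measure_subadditive_finite) auto
        also have "\<dots> \<le> (\<Sum>i<K. \<kappa>)"
          using B(2) by (intro sum_mono) (simp add: less_imp_le)
        also have "\<dots> = real K * \<kappa>"
          by simp
        finally show ?thesis using K K\<kappa> by simp
      qed
      ultimately show ?case by blast
    qed
  qed
qed

text \<open>
  The level is shifted by \<open>\<delta>\<close> in order to absorb the difference between \<open>Y n\<close> and \<open>Z\<close>; the price is
  the probability that \<open>Z\<close> lies in \<open>(a, a + 2 \<delta>]\<close>, which vanishes as \<open>\<delta>\<close> does.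
\<close>

lemma (in prob_space) superlevel_sets_approximable:
  assumes Z[measurable]: "Z \<in> borel_measurable M" and Y[measurable]: "\<And>n. Y n \<in> borel_measurable M"
    and conv: "converges_in_prob M Y Z"
    and G: "\<And>n b. {\<omega> \<in> space M. b < Y n \<omega>} \<in> G n"
  shows "{\<omega> \<in> space M. a < Z \<omega>} \<in> approximable_sets M G"
  unfolding approximable_sets_def
proof (intro CollectI conjI allI impI)
  show "{\<omega> \<in> space M. a < Z \<omega>} \<in> sets M" by measurable
  fix \<epsilon> :: real assume "\<epsilon> > 0"
  define E where "E k = {\<omega> \<in> space M. a < Z \<omega> \<and> Z \<omega> \<le> a + 2 / real (Suc k)}" for k
  have E: "range E \<subseteq> sets M"
    unfolding E_def by auto
  have "decseq E"
  proof (rule decseq_SucI)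
    fix k
    have "2 / real (Suc (Suc k)) \<le> 2 / real (Suc k)"
      by (intro divide_left_mono) auto
    then show "E (Suc k) \<le> E k"
      unfolding E_def by auto
  qed
  moreover have "(\<Inter>k. E k) = {}"
  proof -
    have "\<exists>k. \<omega> \<notin> E k" for \<omega>
    proof (cases "a < Z \<omega>")
      case True
      then obtain k where "inverse (real (Suc k)) < (Z \<omega> - a) / 2"
        using reals_Archimedean[of "(Z \<omega> - a) / 2"] by auto
      then have "\<omega> \<notin> E k" by (simp add: E_def field_simps)
      then show ?thesis by blast
    qed (simp add: E_def)
    then show ?thesis by blast
  qed
  ultimately have "(\<lambda>k. prob (E k)) \<longlonglongrightarrow> 0"
    using finite_Lim_measure_decseq[OF E] by simp
  then have "\<forall>\<^sub>F k in sequentially. prob (E k) < \<epsilon> / 2"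
    using \<open>\<epsilon> > 0\<close> by (intro order_tendstoD) auto
  then obtain k where k: "prob (E k) < \<epsilon> / 2"
    using eventually_happens by force
  define \<delta> where "\<delta> = 1 / real (Suc k)"
  have "\<delta> > 0" by (simp add: \<delta>_def)
  then have "\<forall>\<^sub>F n in sequentially. prob {\<omega> \<in> space M. \<delta> < \<bar>Y n \<omega> - Z \<omega>\<bar>} < \<epsilon> / 2"
    using conv[unfolded converges_in_prob_def, rule_format, of \<delta> "\<epsilon> / 2"] \<open>\<epsilon> > 0\<close> by simp
  then show "\<forall>\<^sub>F n in sequentially. \<exists>B\<in>G n. prob (sym_diff {\<omega> \<in> space M. a < Z \<omega>} B) < \<epsilon>"
  proof eventually_elim
    case (elim n)
    have "sym_diff {\<omega> \<in> space M. a < Z \<omega>} {\<omega> \<in> space M. a + \<delta> < Y n \<omega>}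
        \<subseteq> {\<omega> \<in> space M. \<delta> < \<bar>Y n \<omega> - Z \<omega>\<bar>} \<union> E k"
      using \<open>\<delta> > 0\<close> unfolding E_def \<delta>_def by auto
    then have "prob (sym_diff {\<omega> \<in> space M. a < Z \<omega>} {\<omega> \<in> space M. a + \<delta> < Y n \<omega>})
        \<le> prob ({\<omega> \<in> space M. \<delta> < \<bar>Y n \<omega> - Z \<omega>\<bar>} \<union> E k)"
      using E by (intro finite_measure_mono sets.Un) auto
    also have "\<dots> \<le> prob {\<omega> \<in> space M. \<delta> < \<bar>Y n \<omega> - Z \<omega>\<bar>} + prob (E k)"
      using E by (intro measure_Un_le) auto
    finally show ?case
      using elim k G[of "a + \<delta>" n] by (intro bexI[of _ "{\<omega> \<in> space M. a + \<delta> < Y n \<omega>}"]) auto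
  qed
qed

text \<open>
  At a continuity time \<open>t\<close>, right-continuity shows that the past up to \<open>t\<close> is generated by the values
  at the continuity times up to \<open>t\<close>, for which convergence in probability is available. That \<open>t\<close>
  itself is one of them is essential, because no times after \<open>t\<close> may be used.
\<close>

lemma (in prob_space) natural_filtration_approximable:
  assumes X: "cadlag_process M T X" and Xs: "\<And>n. cadlag_process M T (Xs n)"
    and conv: "\<And>s. s \<in> continuity_times M T X \<Longrightarrow> converges_in_prob M (\<lambda>n. Xs n s) (X s)"
    and t: "t \<in> continuity_times M T X"
  shows "sets (natural_filtration M T X t)
    \<subseteq> approximable_sets M (\<lambda>n. sets (natural_filtration M T (Xs n) t))"
proof -
  let ?G = "\<lambda>n. sets (natural_filtration M T (Xs n) t)"
  have tT: "t \<in> {0..T}" using t unfolding continuity_times_def by blast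
  have G_sub: "?G n \<subseteq> sets M" for n
    using cadlag_processD(1)[OF Xs] by (rule sets_natural_filtration_subset)
  have "sigma_algebra (space M) (?G n)" for n
    using sets.sigma_algebra_axioms[of "natural_filtration M T (Xs n) t"] by simp
  then have alg: "sigma_algebra (space M) (approximable_sets M ?G)"
    using G_sub by (rule sigma_algebra_approximable_sets)
  define N where "N = sigma (space M) (approximable_sets M ?G)"
  have sets_N: "sets N = approximable_sets M ?G"
    unfolding N_def using alg by (rule sigma_algebra.sets_measure_of_eq)
  have space_N: "space N = space M"
    unfolding N_def using alg by (intro space_measure_of) (simp add: sigma_algebra_iff2)
  have at_D: "X s \<in> borel_measurable N" if s: "s \<in> continuity_times M T X" "s \<le> t" for s
    unfolding borel_measurable_iff_greater
  proof
    fix a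
    have sT: "s \<in> {0..T}" using s unfolding continuity_times_def by blast
    have "{\<omega> \<in> space M. b < Xs n s \<omega>} \<in> ?G n" for n b
      using borel_measurable_natural_filtration[OF sT s(2), of "Xs n" M]
      unfolding borel_measurable_iff_greater by simp
    then have "{\<omega> \<in> space M. a < X s \<omega>} \<in> approximable_sets M ?G"
      using cadlag_processD(1)[OF X sT] cadlag_processD(1)[OF Xs sT] conv[OF s(1)]
      by (intro superlevel_sets_approximable)
    then show "{\<omega> \<in> space N. a < X s \<omega>} \<in> sets N"
      by (simp add: sets_N space_N)
  qed
  have at_all: "X s \<in> borel_measurable N" if s: "s \<in> {0..T}" "s \<le> t" for s
  proof (cases "s = t")
    case True
    then show ?thesis using at_D t by simp
  next
    case False
    have "\<exists>r\<in>continuity_times M T X. s < r \<and> r < min t (s + inverse (real (Suc k)))" for k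
    proof -
      have "0 \<le> s" "s < min t (s + inverse (real (Suc k)))" "min t (s + inverse (real (Suc k))) \<le> T"
        using False s tT by auto
      from continuity_times_dense[OF X this] show ?thesis by blast
    qed
    then obtain r where r: "\<And>k. r k \<in> continuity_times M T X" "\<And>k. s < r k"
      "\<And>k. r k < t" "\<And>k. r k < s + inverse (real (Suc k))"
      by (metis min_less_iff_conj)
    have "(\<lambda>k. s + inverse (real (Suc k))) \<longlonglongrightarrow> s + 0"
      by (intro tendsto_add tendsto_const LIMSEQ_inverse_real_of_nat)
    then have r_lim: "r \<longlonglongrightarrow> s"
    proof (intro tendsto_sandwich[of "\<lambda>_. s" r sequentially "\<lambda>k. s + inverse (real (Suc k))"])
      show "\<forall>\<^sub>F k in sequentially. s \<le> r k"
        "\<forall>\<^sub>F k in sequentially. r k \<le> s + inverse (real (Suc k))"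
        using less_imp_le[OF r(2)] less_imp_le[OF r(4)] by simp_all
    qed simp_all
    show ?thesis
    proof (rule borel_measurable_LIMSEQ_real)
      show "X (r k) \<in> borel_measurable N" for k
        using r by (intro at_D) (auto intro: less_imp_le)
      fix \<omega> assume "\<omega> \<in> space N"
      then have "continuous (at s within {s..T}) (\<lambda>u. X u \<omega>)"
        using cadlag_processD(2)[OF X] s unfolding cadlag_def space_N by blast
      moreover have "r k \<in> {s..T}" for k
        using r(2,3)[of k] tT by auto
      ultimately show "(\<lambda>k. X (r k) \<omega>) \<longlonglongrightarrow> X s \<omega>"
        using r_lim unfolding continuous_within_sequentially by (auto simp: comp_def)
    qed
  qed
  have "{X s -` B \<inter> space M | s B. s \<in> {0..T} \<and> s \<le> t \<and> B \<in> sets borel} \<subseteq> sets N"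
  proof clarify
    fix s and B :: "real set" assume s: "s \<in> {0..T}" "s \<le> t" and B: "B \<in> sets borel"
    from measurable_sets[OF at_all[OF s] B]
    show "X s -` B \<inter> space M \<in> sets N"
      by (simp add: space_N)
  qed
  then have "sets (natural_filtration M T X t) \<subseteq> sets N"
    unfolding sets_natural_filtration space_N[symmetric] by (rule sets.sigma_sets_subset)
  then show ?thesis by (simp add: sets_N)
qed

section \<open>Transferring stopping times to the approximating processes\<close>

lemma (in prob_space) expectation_diff_le_of_small_bad_set:
  fixes f g :: "'a \<Rightarrow> real"
  assumes [measurable]: "f \<in> borel_measurable M" "g \<in> borel_measurable M" "Bad \<in> sets M"
    and bound: "\<And>\<omega>. \<omega> \<in> space M \<Longrightarrow> \<bar>f \<omega>\<bar> \<le> C" "\<And>\<omega>. \<omega> \<in> space M \<Longrightarrow> \<bar>g \<omega>\<bar> \<le> C"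
    and good: "\<And>\<omega>. \<omega> \<in> space M - Bad \<Longrightarrow> \<bar>f \<omega> - g \<omega>\<bar> \<le> e" and "e \<ge> 0"
  shows "\<bar>expectation f - expectation g\<bar> \<le> e + 2 * C * prob Bad"
proof -
  have int: "integrable M f" "integrable M g"
    using bound by (auto intro!: integrable_const_bound[where B = C])
  have "\<bar>expectation f - expectation g\<bar> = \<bar>expectation (\<lambda>\<omega>. f \<omega> - g \<omega>)\<bar>"
    using int by simp
  also have "\<dots> \<le> expectation (\<lambda>\<omega>. \<bar>f \<omega> - g \<omega>\<bar>)"
    by (rule integral_abs_bound)
  also have "\<dots> \<le> expectation (\<lambda>\<omega>. e + 2 * C * indicator Bad \<omega>)"
  proof (rule integral_mono)
    show "\<bar>f \<omega> - g \<omega>\<bar> \<le> e + 2 * C * indicator Bad \<omega>" if "\<omega> \<in> space M" for \<omega>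
      using bound[OF that] good[of \<omega>] \<open>e \<ge> 0\<close> that by (cases "\<omega> \<in> Bad") auto
  qed (use int in \<open>auto simp: less_top[symmetric]\<close>)
  also have "\<dots> = e + 2 * C * prob Bad"
    by (simp add: prob_space less_top[symmetric])
  finally show ?thesis .
qed

text \<open>
  The events \<open>\<sigma> \<le> p\<close> are replaced by nearby events of the approximating filtrations, and the new
  stopping time is the first \<open>p\<close> whose event occurs. Off a small set it coincides with \<open>\<sigma>\<close>, and the
  rewards at the finitely many times \<open>p\<close> are close.
\<close>

lemma (in prob_space) transfer_finitely_valued_stopping_time:
  assumes X: "cadlag_process M T X" and Xs: "\<And>n. cadlag_process M T (Xs n)"
    and conv: "\<And>s. s \<in> continuity_times M T X \<Longrightarrow> converges_in_prob M (\<lambda>n. Xs n s) (X s)"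
    and \<gamma>: "continuous_on ({0..} \<times> UNIV) (\<gamma> :: real \<times> real \<Rightarrow> real)"
    and C: "\<And>t x. 0 \<le> t \<Longrightarrow> \<bar>\<gamma> (t, x)\<bar> \<le> C"
    and \<sigma>: "\<sigma> \<in> stopping_times_upto M (natural_filtration M T X) L"
    and P: "finite P" "P \<subseteq> continuity_times M T X \<inter> {0..L}" "L \<in> P"
    and \<sigma>P: "\<And>\<omega>. \<omega> \<in> space M \<Longrightarrow> \<sigma> \<omega> \<in> P"
    and "\<epsilon> > 0"
  shows "\<forall>\<^sub>F n in sequentially. \<exists>\<sigma>'\<in>stopping_times_upto M (natural_filtration M T (Xs n)) L.
    expectation (\<lambda>\<omega>. \<gamma> (\<sigma> \<omega>, X (\<sigma> \<omega>) \<omega>)) - \<epsilon> \<le> expectation (\<lambda>\<omega>. \<gamma> (\<sigma>' \<omega>, Xs n (\<sigma>' \<omega>) \<omega>))"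
proof -
  have PT: "p \<in> {0..T}" "0 \<le> p" "p \<le> L" if "p \<in> P" for p
    using P(2) that unfolding continuity_times_def by auto
  have "C \<ge> 0" using C[of 0 0] by auto
  define N where "N = real (card P)"
  have "N > 0" using P by (auto simp: N_def card_gt_0_iff)
  \<comment> \<open>The bad set consists of two events of probability at most \<open>\<kappa>\<close> for each of the \<open>N\<close> times, and on it the
    rewards differ by at most \<open>2 C\<close>; using \<open>C + 1\<close> avoids a division by zero.\<close>
  define S where "S = (C + 1) * N"
  have "S > 0" using \<open>C \<ge> 0\<close> \<open>N > 0\<close> by (simp add: S_def)
  define \<kappa> where "\<kappa> = \<epsilon> / (8 * S)"
  have "\<kappa> > 0" using \<open>\<epsilon> > 0\<close> \<open>S > 0\<close> by (simp add: \<kappa>_def)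
  have "2 * C * (N * (2 * \<kappa>)) \<le> 2 * (C + 1) * (N * (2 * \<kappa>))"
    using \<open>\<kappa> > 0\<close> \<open>N > 0\<close> by (intro mult_right_mono) auto
  also have "\<dots> = 4 * (S * \<kappa>)"
    by (simp add: S_def algebra_simps)
  also have "S * \<kappa> = \<epsilon> / 8"
    using \<open>S > 0\<close> by (simp add: \<kappa>_def)
  finally have budget: "2 * C * (N * (2 * \<kappa>)) \<le> \<epsilon> / 2" by simp
  define A where "A p = {\<omega> \<in> space M. \<sigma> \<omega> \<le> p}" for p
  have \<sigma>_meas: "\<sigma> \<in> borel_measurable M"
    using X \<sigma> by (rule borel_measurable_stopping_times_upto)
  have A_approx: "A p \<in> approximable_sets M (\<lambda>n. sets (natural_filtration M T (Xs n) p))" if "p \<in> P" for p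
    using natural_filtration_approximable[OF X Xs conv, of p] stopping_times_uptoD(2)[OF \<sigma>, of p]
      P(2) that unfolding A_def by blast
  have A_sets: "A p \<in> sets M" if "p \<in> P" for p
    using A_approx[OF that] unfolding approximable_sets_def by blast
  have ev1: "\<forall>\<^sub>F n in sequentially. \<forall>p\<in>P.
      \<exists>B\<in>sets (natural_filtration M T (Xs n) p). prob (sym_diff (A p) B) < \<kappa>"
    using A_approx \<open>\<kappa> > 0\<close> P(1) unfolding approximable_sets_def
    by (intro eventually_ball_finite) auto
  have meas: "X p \<in> borel_measurable M" "Xs n p \<in> borel_measurable M"
    "(\<lambda>\<omega>. \<gamma> (p, X p \<omega>)) \<in> borel_measurable M" "(\<lambda>\<omega>. \<gamma> (p, Xs n p \<omega>)) \<in> borel_measurable M"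
    if "p \<in> P" for p n
  proof -
    show X_meas: "X p \<in> borel_measurable M" and Xs_meas: "Xs n p \<in> borel_measurable M"
      by (rule cadlag_processD(1)[OF X PT(1)[OF that]] cadlag_processD(1)[OF Xs PT(1)[OF that]])+
    show "(\<lambda>\<omega>. \<gamma> (p, X p \<omega>)) \<in> borel_measurable M"
      by (rule borel_measurable_reward[OF \<gamma> borel_measurable_const X_meas PT(2)[OF that]])
    show "(\<lambda>\<omega>. \<gamma> (p, Xs n p \<omega>)) \<in> borel_measurable M"
      by (rule borel_measurable_reward[OF \<gamma> borel_measurable_const Xs_meas PT(2)[OF that]])
  qed
  define D where "D n p = {\<omega> \<in> space M. \<epsilon> / 2 < \<bar>\<gamma> (p, Xs n p \<omega>) - \<gamma> (p, X p \<omega>)\<bar>}" for n p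
  have D_sets: "D n p \<in> sets M" if "p \<in> P" for n p
  proof -
    note [measurable] = meas(3,4)[OF that]
    show ?thesis unfolding D_def by measurable
  qed
  have "\<forall>\<^sub>F n in sequentially. prob (D n p) < \<kappa>" if p: "p \<in> P" for p
  proof -
    have cont: "continuous_on UNIV (\<lambda>x. \<gamma> (p, x))"
      using PT[OF p] by (intro continuous_on_compose2[OF \<gamma>] continuous_intros) auto
    have "converges_in_prob M (\<lambda>n \<omega>. \<gamma> (p, Xs n p \<omega>)) (\<lambda>\<omega>. \<gamma> (p, X p \<omega>))"
    proof (rule converges_in_prob_continuous[OF meas(2)[OF p] meas(1)[OF p] conv cont])
      show "p \<in> continuity_times M T X" using P(2) p by blast
    qed
    from this[unfolded converges_in_prob_def, rule_format, of "\<epsilon> / 2" \<kappa>]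
    show ?thesis
      using \<open>\<epsilon> > 0\<close> \<open>\<kappa> > 0\<close> unfolding D_def by simp
  qed
  then have ev2: "\<forall>\<^sub>F n in sequentially. \<forall>p\<in>P. prob (D n p) < \<kappa>"
    using P(1) by (intro eventually_ball_finite) auto
  from ev1 ev2 show ?thesis
  proof eventually_elim
    case (elim n)
    then obtain B where B: "\<And>p. p \<in> P \<Longrightarrow> B p \<in> sets (natural_filtration M T (Xs n) p)"
      "\<And>p. p \<in> P \<Longrightarrow> prob (sym_diff (A p) (B p)) < \<kappa>"
      by metis
    have B_sets: "B p \<in> sets M" if "p \<in> P" for p
      using sets_natural_filtration_subset[OF cadlag_processD(1)[OF Xs]] B(1)[OF that] by (rule subsetD)
    define \<sigma>' where "\<sigma>' = (\<lambda>\<omega>. first_accepted P L (\<lambda>p. \<omega> \<in> B p))"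
    have \<sigma>': "\<sigma>' \<in> stopping_times_upto M (natural_filtration M T (Xs n)) L"
      unfolding \<sigma>'_def
    proof (rule first_accepted_stopping_time[OF P(1)])
      show "P \<subseteq> {0..L}" "0 \<le> L"
        using P(2,3) by auto
      fix p assume p: "p \<in> P"
      have "{\<omega> \<in> space M. \<omega> \<in> B p} = B p"
        using sets.sets_into_space[OF B_sets[OF p]] by blast
      then show "{\<omega> \<in> space M. \<omega> \<in> B p} \<in> sets (natural_filtration M T (Xs n) p)"
        using B(1)[OF p] by simp
    qed
    have \<sigma>'_meas: "\<sigma>' \<in> borel_measurable M"
      using Xs \<sigma>' by (rule borel_measurable_stopping_times_upto)
    have \<sigma>'P: "\<sigma>' \<omega> \<in> P" for \<omega>
      unfolding \<sigma>'_def using first_accepted_mem[OF P(1), of L] P(3) by (metis insert_absorb)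
    define Bad where "Bad = (\<Union>p\<in>P. sym_diff (A p) (B p) \<union> D n p)"
    have piece: "sym_diff (A p) (B p) \<in> sets M" "D n p \<in> sets M" if "p \<in> P" for p
      by (intro sets.Un sets.Diff A_sets B_sets D_sets that)+
    have Bad_sets: "Bad \<in> sets M"
      unfolding Bad_def by (intro sets.finite_UN P(1) sets.Un[OF piece])
    have "prob Bad \<le> (\<Sum>p\<in>P. prob (sym_diff (A p) (B p) \<union> D n p))"
      unfolding Bad_def using sets.Un[OF piece]
      by (intro finite_measure_subadditive_finite P(1) image_subsetI)
    also have "\<dots> \<le> (\<Sum>p\<in>P. 2 * \<kappa>)"
    proof (rule sum_mono)
      fix p assume p: "p \<in> P"
      have "prob (sym_diff (A p) (B p) \<union> D n p) \<le> prob (sym_diff (A p) (B p)) + prob (D n p)"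
        by (rule measure_Un_le[OF piece[OF p]])
      moreover have "prob (sym_diff (A p) (B p)) < \<kappa>" "prob (D n p) < \<kappa>"
        using B(2)[OF p] elim(2) p by blast+
      ultimately show "prob (sym_diff (A p) (B p) \<union> D n p) \<le> 2 * \<kappa>"
        by linarith
    qed
    also have "\<dots> = N * (2 * \<kappa>)"
      by (simp add: N_def)
    finally have "2 * C * prob Bad \<le> 2 * C * (N * (2 * \<kappa>))"
      using \<open>C \<ge> 0\<close> by (intro mult_left_mono) auto
    then have small: "2 * C * prob Bad \<le> \<epsilon> / 2"
      using budget by linarith
    have "\<bar>expectation (\<lambda>\<omega>. \<gamma> (\<sigma>' \<omega>, Xs n (\<sigma>' \<omega>) \<omega>)) - expectation (\<lambda>\<omega>. \<gamma> (\<sigma> \<omega>, X (\<sigma> \<omega>) \<omega>))\<bar>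
        \<le> \<epsilon> / 2 + 2 * C * prob Bad"
    proof (rule expectation_diff_le_of_small_bad_set)
      have "(\<lambda>\<omega>. Xs n (\<sigma>' \<omega>) \<omega>) \<in> borel_measurable M"
        using \<sigma>'_meas P(1) \<sigma>'P meas(2) by (rule borel_measurable_at_finitely_many_times)
      from borel_measurable_reward[OF \<gamma> \<sigma>'_meas this PT(2)[OF \<sigma>'P]]
      show "(\<lambda>\<omega>. \<gamma> (\<sigma>' \<omega>, Xs n (\<sigma>' \<omega>) \<omega>)) \<in> borel_measurable M" .
      have "(\<lambda>\<omega>. X (\<sigma> \<omega>) \<omega>) \<in> borel_measurable M"
        using \<sigma>_meas P(1) \<sigma>P meas(1) by (rule borel_measurable_at_finitely_many_times)
      from borel_measurable_reward[OF \<gamma> \<sigma>_meas this PT(2)[OF \<sigma>P]]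
      show "(\<lambda>\<omega>. \<gamma> (\<sigma> \<omega>, X (\<sigma> \<omega>) \<omega>)) \<in> borel_measurable M" .
      show "Bad \<in> sets M" by fact
      show "\<bar>\<gamma> (\<sigma>' \<omega>, Xs n (\<sigma>' \<omega>) \<omega>)\<bar> \<le> C" for \<omega>
        by (rule C[OF PT(2)[OF \<sigma>'P]])
      show "\<bar>\<gamma> (\<sigma> \<omega>, X (\<sigma> \<omega>) \<omega>)\<bar> \<le> C" if "\<omega> \<in> space M" for \<omega>
        by (rule C[OF PT(2)[OF \<sigma>P[OF that]]])
      show "\<bar>\<gamma> (\<sigma>' \<omega>, Xs n (\<sigma>' \<omega>) \<omega>) - \<gamma> (\<sigma> \<omega>, X (\<sigma> \<omega>) \<omega>)\<bar> \<le> \<epsilon> / 2" if \<omega>: "\<omega> \<in> space M - Bad" for \<omega>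
      proof -
        have "\<omega> \<in> B p \<longleftrightarrow> \<sigma> \<omega> \<le> p" if "p \<in> P" for p
          using \<omega> that unfolding Bad_def A_def by blast
        then have "{p \<in> P. \<omega> \<in> B p} = {p \<in> P. \<sigma> \<omega> \<le> p}"
          by blast
        then have "\<sigma>' \<omega> = first_accepted P L (\<lambda>p. \<sigma> \<omega> \<le> p)"
          unfolding \<sigma>'_def first_accepted_def by simp
        also have "\<dots> = \<sigma> \<omega>"
          using \<omega> by (intro first_accepted_eq P(1) \<sigma>P PT(3)) auto
        finally have "\<sigma>' \<omega> = \<sigma> \<omega>" .
        moreover have "\<omega> \<notin> D n (\<sigma> \<omega>)"
          using \<omega> \<sigma>P[of \<omega>] unfolding Bad_def by blast
        ultimately show ?thesis
          using \<omega> unfolding D_def by auto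
      qed
      show "0 \<le> \<epsilon> / 2" using \<open>\<epsilon> > 0\<close> by simp
    qed
    then have "expectation (\<lambda>\<omega>. \<gamma> (\<sigma> \<omega>, X (\<sigma> \<omega>) \<omega>)) - \<epsilon> \<le> expectation (\<lambda>\<omega>. \<gamma> (\<sigma>' \<omega>, Xs n (\<sigma>' \<omega>) \<omega>))"
      using small by linarith
    then show ?case
      using \<sigma>' by (rule bexI)
  qed
qed

lemma (in prob_space) expectation_reward_bound:
  fixes \<gamma> :: "real \<times> real \<Rightarrow> real"
  assumes C: "\<And>t x. 0 \<le> t \<Longrightarrow> \<bar>\<gamma> (t, x)\<bar> \<le> C"
    and "\<tau> \<in> stopping_times_upto M F L"
  shows "\<bar>expectation (\<lambda>\<omega>. \<gamma> (\<tau> \<omega>, X (\<tau> \<omega>) \<omega>))\<bar> \<le> C"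
proof (cases "integrable M (\<lambda>\<omega>. \<gamma> (\<tau> \<omega>, X (\<tau> \<omega>) \<omega>))")
  case True
  have *: "\<bar>\<gamma> (\<tau> \<omega>, X (\<tau> \<omega>) \<omega>)\<bar> \<le> C" if "\<omega> \<in> space M" for \<omega>
    using assms that unfolding stopping_times_upto_def by auto
  have "\<bar>expectation (\<lambda>\<omega>. \<gamma> (\<tau> \<omega>, X (\<tau> \<omega>) \<omega>))\<bar> \<le> expectation (\<lambda>\<omega>. \<bar>\<gamma> (\<tau> \<omega>, X (\<tau> \<omega>) \<omega>)\<bar>)"
    by (rule integral_abs_bound)
  also have "\<dots> \<le> C"
    using True * by (intro integral_le_const) auto
  finally show ?thesis .
next
  case False
  \<comment> \<open>The expectation then takes the default value \<open>0\<close>.\<close>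
  then show ?thesis
    using C[of 0 0] by (simp add: not_integrable_integral_eq)
qed

lemma (in prob_space) bdd_above_rewards:
  fixes \<gamma> :: "real \<times> real \<Rightarrow> real"
  assumes C: "\<And>t x. 0 \<le> t \<Longrightarrow> \<bar>\<gamma> (t, x)\<bar> \<le> C"
  shows "bdd_above ((\<lambda>\<tau>. expectation (\<lambda>\<omega>. \<gamma> (\<tau> \<omega>, X (\<tau> \<omega>) \<omega>))) ` stopping_times_upto M F L)"
proof (rule bdd_aboveI2)
  fix \<tau> assume \<tau>: "\<tau> \<in> stopping_times_upto M F L"
  show "expectation (\<lambda>\<omega>. \<gamma> (\<tau> \<omega>, X (\<tau> \<omega>) \<omega>)) \<le> C"
    using C by (rule abs_le_D1[OF expectation_reward_bound[OF _ \<tau>]])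
qed

lemma (in prob_space) le_optimal_value:
  fixes \<gamma> :: "real \<times> real \<Rightarrow> real"
  assumes C: "\<And>t x. 0 \<le> t \<Longrightarrow> \<bar>\<gamma> (t, x)\<bar> \<le> C"
    and \<tau>: "\<tau> \<in> stopping_times_upto M (natural_filtration M T X) L"
  shows "expectation (\<lambda>\<omega>. \<gamma> (\<tau> \<omega>, X (\<tau> \<omega>) \<omega>)) \<le> optimal_value M T \<gamma> X L"
  unfolding optimal_value_def using C by (intro cSUP_upper[OF \<tau>] bdd_above_rewards)

theorem theorem4:
  fixes M :: "'a measure" and T L :: real
    and \<gamma> :: "real \<times> real \<Rightarrow> real"
    and X :: "real \<Rightarrow> 'a \<Rightarrow> real" and Xs :: "nat \<Rightarrow> real \<Rightarrow> 'a \<Rightarrow> real"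
  assumes "prob_space M"
    and "T > 0" and "L \<in> {0..T}"
    and "continuous_on ({0..} \<times> UNIV) \<gamma>" and "bounded (\<gamma> ` ({0..} \<times> UNIV))"
    and "cadlag_process M T X"
    and "\<P>(\<omega> in M. jump (\<lambda>t. X t \<omega>) L \<noteq> 0) = 0"
    and "\<And>n. cadlag_process M T (Xs n)"
    and "skorokhod_tendsto_in_prob M T Xs X"
  shows "ereal (optimal_value M T \<gamma> X L) \<le> liminf (\<lambda>n. ereal (optimal_value M T \<gamma> (Xs n) L))"
proof -
  interpret prob_space M by (rule assms(1))
  note L = assms(3) and \<gamma> = assms(4) and X = assms(6) and Xs = assms(8)
  obtain C where C: "\<And>t x. 0 \<le> t \<Longrightarrow> \<bar>\<gamma> (t, x)\<bar> \<le> C"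
    using assms(5) unfolding bounded_iff by auto
  have [measurable]: "(\<lambda>\<omega>. jump (\<lambda>t. X t \<omega>) L) \<in> borel_measurable M"
    by (rule borel_measurable_jump[OF X L])
  have "{\<omega> \<in> space M. jump (\<lambda>t. X t \<omega>) L \<noteq> 0} \<in> sets M"
    by measurable
  then have "AE \<omega> in M. jump (\<lambda>t. X t \<omega>) L = 0"
    using assms(7) by (subst (asm) prob_eq_0) (auto elim!: AE_mp intro!: AE_I2)
  then have LD: "L \<in> continuity_times M T X"
    using L unfolding continuity_times_def by blast
  have conv: "converges_in_prob M (\<lambda>n. Xs n s) (X s)" if "s \<in> continuity_times M T X" for s
    using X Xs assms(9) that by (rule skorokhod_converges_at_continuity_time)
  have "\<exists>t\<in>continuity_times M T X. a < t \<and> t < b" if "0 \<le> a" "a < b" "b \<le> L" for a b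
    using continuity_times_dense[OF X, of a b] that L by auto
  then obtain P where P: "\<And>k. finite (P k)" "\<And>k. P k \<subseteq> continuity_times M T X \<inter> {0..L}"
    "\<And>t. t \<in> {0..L} \<Longrightarrow> (\<lambda>k. first_accepted (P k) L (\<lambda>p. t \<le> p)) \<longlonglongrightarrow> t"
    using finite_grids_in_dense_set[of L "continuity_times M T X"] by blast
  have PL: "P k \<subseteq> {0..L}" for k
    using P(2) by blast
  have ev: "\<forall>\<^sub>F n in sequentially. expectation (\<lambda>\<omega>. \<gamma> (\<tau> \<omega>, X (\<tau> \<omega>) \<omega>)) - e \<le> optimal_value M T \<gamma> (Xs n) L"
    if \<tau>: "\<tau> \<in> stopping_times_upto M (natural_filtration M T X) L" and "e > 0" for \<tau> e
  proof -
    define \<sigma> where "\<sigma> = (\<lambda>k \<omega>. first_accepted (P k) L (\<lambda>p. \<tau> \<omega> \<le> p))"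
    have \<sigma>: "\<sigma> k \<in> stopping_times_upto M (natural_filtration M T X) L" for k
      unfolding \<sigma>_def using X L \<gamma> C \<tau> P(1) PL P(3) by (rule expectation_rounded_up_tendsto(1))
    have \<sigma>_lim: "(\<lambda>k. expectation (\<lambda>\<omega>. \<gamma> (\<sigma> k \<omega>, X (\<sigma> k \<omega>) \<omega>)))
        \<longlonglongrightarrow> expectation (\<lambda>\<omega>. \<gamma> (\<tau> \<omega>, X (\<tau> \<omega>) \<omega>))"
      unfolding \<sigma>_def using X L \<gamma> C \<tau> P(1) PL P(3) by (rule expectation_rounded_up_tendsto(2))
    have "\<forall>\<^sub>F k in sequentially. expectation (\<lambda>\<omega>. \<gamma> (\<tau> \<omega>, X (\<tau> \<omega>) \<omega>)) - e / 2
        < expectation (\<lambda>\<omega>. \<gamma> (\<sigma> k \<omega>, X (\<sigma> k \<omega>) \<omega>))"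
      using \<open>e > 0\<close> by (intro order_tendstoD(1)[OF \<sigma>_lim]) simp
    then obtain k where k: "expectation (\<lambda>\<omega>. \<gamma> (\<tau> \<omega>, X (\<tau> \<omega>) \<omega>)) - e / 2
        < expectation (\<lambda>\<omega>. \<gamma> (\<sigma> k \<omega>, X (\<sigma> k \<omega>) \<omega>))"
      using eventually_happens by force
    have "\<forall>\<^sub>F n in sequentially. \<exists>\<sigma>'\<in>stopping_times_upto M (natural_filtration M T (Xs n)) L.
        expectation (\<lambda>\<omega>. \<gamma> (\<sigma> k \<omega>, X (\<sigma> k \<omega>) \<omega>)) - e / 2
        \<le> expectation (\<lambda>\<omega>. \<gamma> (\<sigma>' \<omega>, Xs n (\<sigma>' \<omega>) \<omega>))"
    proof (rule transfer_finitely_valued_stopping_time[OF X Xs conv \<gamma> C \<sigma>])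
      show "finite (insert L (P k))" "L \<in> insert L (P k)"
        using P(1) by auto
      show "insert L (P k) \<subseteq> continuity_times M T X \<inter> {0..L}"
        using P(2)[of k] LD L by auto
      show "\<sigma> k \<omega> \<in> insert L (P k)" for \<omega>
        unfolding \<sigma>_def using P(1) by (rule first_accepted_mem)
      show "e / 2 > 0" using \<open>e > 0\<close> by simp
    qed auto
    then show ?thesis
    proof eventually_elim
      case (elim n)
      then obtain \<sigma>' where \<sigma>': "\<sigma>' \<in> stopping_times_upto M (natural_filtration M T (Xs n)) L"
        "expectation (\<lambda>\<omega>. \<gamma> (\<sigma> k \<omega>, X (\<sigma> k \<omega>) \<omega>)) - e / 2
          \<le> expectation (\<lambda>\<omega>. \<gamma> (\<sigma>' \<omega>, Xs n (\<sigma>' \<omega>) \<omega>))"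
        by blast
      then show ?case
        using le_optimal_value[of \<gamma> C, OF C \<sigma>'(1)] k by linarith
    qed
  qed
  have "(\<lambda>_. first_accepted {} L (\<lambda>_. True)) \<in> stopping_times_upto M (natural_filtration M T X) L"
    using L by (intro first_accepted_stopping_time) auto
  then have nonempty: "stopping_times_upto M (natural_filtration M T X) L \<noteq> {}"
    by blast
  have near_optimal: "\<exists>\<tau>\<in>stopping_times_upto M (natural_filtration M T X) L.
      y < expectation (\<lambda>\<omega>. \<gamma> (\<tau> \<omega>, X (\<tau> \<omega>) \<omega>))" if "y < optimal_value M T \<gamma> X L" for y
    using that less_cSUP_iff[OF nonempty bdd_above_rewards[of \<gamma> C, OF C, where X = X], of y]
    unfolding optimal_value_def by blast
  show ?thesis
  proof (rule ereal_le_epsilon2)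
    fix e :: real assume "e > 0"
    have "optimal_value M T \<gamma> X L - e / 2 < optimal_value M T \<gamma> X L"
      using \<open>e > 0\<close> by simp
    then obtain \<tau> where \<tau>: "\<tau> \<in> stopping_times_upto M (natural_filtration M T X) L"
      "optimal_value M T \<gamma> X L - e / 2 < expectation (\<lambda>\<omega>. \<gamma> (\<tau> \<omega>, X (\<tau> \<omega>) \<omega>))"
      using near_optimal by blast
    have "\<forall>\<^sub>F n in sequentially. ereal (optimal_value M T \<gamma> X L - e) \<le> ereal (optimal_value M T \<gamma> (Xs n) L)"
      using ev[OF \<tau>(1), of "e / 2"] \<tau>(2) \<open>e > 0\<close> by (auto elim!: eventually_mono)
    then have "ereal (optimal_value M T \<gamma> X L - e) \<le> liminf (\<lambda>n. ereal (optimal_value M T \<gamma> (Xs n) L))"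
      by (rule Liminf_bounded)
    then have "ereal (optimal_value M T \<gamma> X L - e) + ereal e
        \<le> liminf (\<lambda>n. ereal (optimal_value M T \<gamma> (Xs n) L)) + ereal e"
      by (rule add_right_mono)
    then show "ereal (optimal_value M T \<gamma> X L)
        \<le> liminf (\<lambda>n. ereal (optimal_value M T \<gamma> (Xs n) L)) + ereal e"
      by simp
  qed
qed

end
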